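(* Let $\{(S_n,J_n);n\ge0\}$ be a discrete-time Markov additive process as in the context satisfying the assumptions listed there, with mean drift $h$, and let $M_n=\max_{0\le k\le n}S_k$. Let $T$ be a nonnegative random variable independent of $\{(S_n,J_n)\}$. Suppose that $T\in\mathcal{C}$, $\mathbb{E}[T]<\infty$, and (entrywise) $$\int_{|y|>x}d\boldsymbol{\beta}(y)=o(\mathbb{P}(T>x)),\qquad \int_{|y|>x}d\boldsymbol{H}(y)=o(\mathbb{P}(T>x)).$$ Then $\mathbb{P}(S_{\lfloor T\rfloor}>hx)\sim\mathbb{P}(M_{\lfloor T\rfloor}>hx)\sim\mathbb{P}(T>x)$ as $x\to\infty$.
   Context: Let $\mathbb{D}=\{0,1,\dots,d-1\}$. $\{J_n\}$ is a Markov chain on $\mathbb{D}$ and $X_0,X_1,\dots$ are real random variables such that $\mathbb{P}(X_0\le x,J_0=i)=\beta_i(x)$ and, for $n\ge0$, conditionally on the past up to time $n$ and on $J_n=i$, $\mathbb{P}(X_{n+1}\le x,J_{n+1}=j\mid\cdot)=H_{i,j}(x)$, where $\sum_i\beta_i(\infty)=1$ and $\sum_jH_{i,j}(\infty)=1$. Let $S_n=\sum_{\nu=0}^nX_\nu$, $\boldsymbol{\beta}(x)=(\beta_i(x))_{i}$ (row vector), $\boldsymbol{H}(x)=(H_{i,j}(x))_{i,j}$. Assumptions: $\boldsymbol{H}(\infty)$ is an irreducible stochastic matrix, and $h:=\boldsymbol{\varpi}\int_{\mathbb{R}}x\,d\boldsymbol{H}(x)\mathbf{e}\in(0,\infty)$,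 where $\boldsymbol{\varpi}$ is the stationary probability vector of $\boldsymbol{H}(\infty)$ and $\mathbf{e}$ the all-ones column vector. $f\sim g$ means $f/g\to1$, $f=o(g)$ means $f/g\to0$. Class $\mathcal{C}$: nonnegative $X$ with $\mathbb{P}(X>x)>0$ for all $x\ge0$ and $\lim_{v\downarrow1}\liminf_{x\to\infty}\mathbb{P}(X>vx)/\mathbb{P}(X>x)=1$. *)

theory Defs
  imports "HOL-Probability.Probability" "HOL-Library.Landau_Symbols"
begin

definition mapS :: "(nat \<Rightarrow> 'a \<Rightarrow> real) \<Rightarrow> nat \<Rightarrow> 'a \<Rightarrow> real" where
  "mapS X n \<omega> = (\<Sum>\<nu>\<le>n. X \<nu> \<omega>)"

definition mapM :: "(nat \<Rightarrow> 'a \<Rightarrow> real) \<Rightarrow> nat \<Rightarrow> 'a \<Rightarrow> real" where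
  "mapM X n \<omega> = Max ((\<lambda>k. mapS X k \<omega>) ` {..n})"

definition past_events ::
  "'a measure \<Rightarrow> (nat \<Rightarrow> 'a \<Rightarrow> real) \<Rightarrow> (nat \<Rightarrow> 'a \<Rightarrow> nat) \<Rightarrow> nat \<Rightarrow> 'a set set" where
  "past_events M X J n = sigma_sets (space M)
     (\<Union>k\<in>{..n}. {X k -` B \<inter> space M | B. B \<in> sets borel} \<union> {J k -` C \<inter> space M | C. True})"

definition irreducible_matrix :: "nat \<Rightarrow> (nat \<Rightarrow> nat \<Rightarrow> real) \<Rightarrow> bool" where
  "irreducible_matrix d P \<longleftrightarrow>
     (\<forall>i<d. \<forall>j<d. (i, j) \<in> {(a, b). a < d \<and> b < d \<and> P a b > 0}\<^sup>+)"

definition stochastic_matrix :: "nat \<Rightarrow> (nat \<Rightarrow> nat \<Rightarrow> real) \<Rightarrow> bool" where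
  "stochastic_matrix d P \<longleftrightarrow>
     (\<forall>i<d. \<forall>j<d. P i j \<ge> 0) \<and> (\<forall>i<d. (\<Sum>j<d. P i j) = 1)"

definition classC :: "'a measure \<Rightarrow> ('a \<Rightarrow> real) \<Rightarrow> bool" where
  "classC M T \<longleftrightarrow>
     (\<forall>\<omega>\<in>space M. T \<omega> \<ge> 0) \<and>
     (\<forall>x\<ge>0. measure M {\<omega>\<in>space M. T \<omega> > x} > 0) \<and>
     ((\<lambda>v. Liminf at_top (\<lambda>x. ereal (measure M {\<omega>\<in>space M. T \<omega> > v * x}
                                        / measure M {\<omega>\<in>space M. T \<omega> > x})))
        \<longlongrightarrow> 1) (at_right 1)"

end

theory Submission
  imports Defs "Jordan_Normal_Form.Determinant"
begin

text \<open>
  Write \<open>Q(x) = P(T > x)\<close>. Since \<open>T\<close> is in class C, replacing \<open>x\<close> by \<open>v x\<close> with \<open>v\<close> close to 1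
  hardly changes \<open>Q(x)\<close>. The lower bound is then the weak law of large numbers for \<open>S\<close> on
  \<open>T > v x\<close>. For the upper bound one shows that \<open>M\<^sub>N > h x\<close> together with \<open>T \<le> x / v\<close> has
  probability \<open>o(Q(x))\<close>. Either some jump exceeds \<open>\<delta> x\<close>, which costs at most \<open>E[T]\<close> times the
  jump tail, or the process \<open>S\<close> with drift slightly more than \<open>h\<close> removed climbs \<open>K\<close> times in
  succession by an amount \<open>\<delta> x\<close> within \<open>n\<close> steps. A single climb has conditional probability at most
  \<open>n g(\<delta> x) / (\<delta> x)\<close> with \<open>g \<rightarrow> 0\<close>, by Kolmogorov's inequality for the truncated jumps made into
  martingale differences with a solution of the Poisson equation of the modulating chain. So
  \<open>K\<close> climbs have probability at most the \<open>K\<close>-th power of this, and \<open>E[(T / x)\<^sup>K; T \<le> x] = O(Q(x))\<close>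
  for large \<open>K\<close> by dominated variation. Only first moments of the jumps enter.
\<close>

section \<open>The Poisson equation of an irreducible chain\<close>

unbundle no vec_syntax

text \<open>One climb is not enough. Integrating its bound over \<open>T\<close> leaves a term of
  order o(1/x), whereas a finite mean already forces Q(x) = o(1/x), and Q may be far smaller. The
  K-th power replaces 1/x by E[(T/x)^K; T \<le> x], which is comparable with Q(x). This is why every
  estimate below is conditional on an event of the past and uniform in the starting time: it has to
  be restarted at first passages. With first moments only, jumps truncated at z have second moment
  o(z), not O(1). That suffices: in n V(z) / z^2 one factor V(z) / z tends to 0 and n / z remains,
  which is what the K-th power needs. The gap between x/v and x pays for three things: the drift
  raised above h (truncated means only converge to the true ones), the initial value, and the K
  climbs with their overshoots. Dominated variation enters a second time: jumps are cut at \<delta>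
  x, and Q(\<delta> x) = O(Q(x)) keeps their tails o(Q(x)).\<close>

text \<open>Maximum principle: where \<open>f\<close> is maximal it equals an average of values that
  are no larger, so every successor of positive probability is maximal too. Irreducibility carries
  this to all states.\<close>

lemma irreducible_harmonic_const:
  assumes st: "stochastic_matrix d P" and irr: "irreducible_matrix d P" and d: "d > 0"
    and harm: "\<And>i. i < d \<Longrightarrow> f i = (\<Sum>j<d. P i j * f j)"
    and i: "i < d" and j: "j < d"
  shows "f i = (f j :: real)"
proof -
  have fin: "finite (f ` {..<d})" and ne: "f ` {..<d} \<noteq> {}" using d by auto
  from Max_in[OF fin ne] obtain a where a_Max: "a < d" "Max (f ` {..<d}) = f a" by auto
  then have a: "a < d" "\<And>b. b < d \<Longrightarrow> f b \<le> f a" using Max_ge[OF fin] by auto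
  have neighbour: "f c = f a" if "f b = f a" "b < d" "c < d" "P b c > 0" for b c
  proof -
    have nn: "\<And>j. j < d \<Longrightarrow> 0 \<le> P b j * (f a - f j)"
      using st a that(2) unfolding stochastic_matrix_def by auto
    have "(\<Sum>j<d. P b j * (f a - f j)) = (\<Sum>j<d. P b j) * f a - (\<Sum>j<d. P b j * f j)"
      by (simp add: algebra_simps sum_subtractf sum_distrib_left)
    also have "\<dots> = f a - f b"
      using st that(2) unfolding harm[OF that(2), symmetric] by (simp add: stochastic_matrix_def)
    also have "\<dots> = 0" using that(1) by simp
    finally have "P b c * (f a - f c) = 0"
      using nn that(3) by (subst (asm) sum_nonneg_eq_0_iff) auto
    then show ?thesis using that(4) by simp
  qed
  have "f c = f a" if "c < d" for c
  proof -
    have "(a, c) \<in> {(a, b). a < d \<and> b < d \<and> P a b > 0}\<^sup>+"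
      using irr a(1) that unfolding irreducible_matrix_def by auto
    then show ?thesis
    proof (induction rule: trancl_induct)
      case (base y)
      then show ?case using neighbour[of a y] a(1) by simp
    next
      case (step y z)
      then show ?case using neighbour[of y z] by simp
    qed
  qed
  from this[OF i] this[OF j] show ?thesis by simp
qed

text \<open>Used with \<open>g i\<close> the mean jump out of state \<open>i\<close> minus
  \<open>h\<close>. Then X(n+1) + f(J(n+1)) - f(J(n)) has conditional mean \<open>h\<close> whatever
  the state, and the correction by \<open>f\<close> telescopes to a bounded term. The hypothesis on
  \<open>g\<close> is the solvability condition.\<close>

lemma poisson_equation:
  fixes P :: "nat \<Rightarrow> nat \<Rightarrow> real"
  assumes st: "stochastic_matrix d P" and irr: "irreducible_matrix d P" and d: "d > 0"
    and w_sum: "(\<Sum>i<d. w i) = 1"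
    and w_stat: "\<And>j. j < d \<Longrightarrow> (\<Sum>i<d. w i * P i j) = w j"
    and g: "(\<Sum>i<d. w i * g i) = 0"
  obtains f where "\<And>i. i < d \<Longrightarrow> f i - (\<Sum>j<d. P i j * f j) = g i"
proof -
  \<comment> \<open>Adding the rank-one term makes \<open>I - P\<close> injective: a kernel vector is annihilated by \<open>w\<close>, hence
    harmonic, hence constant, hence 0.\<close>
  define A where "A = mat d d (\<lambda>(i, j). (if i = j then 1 else 0) - P i j + w j)"
  have A: "A \<in> carrier_mat d d" unfolding A_def by simp
  have Av: "(A *\<^sub>v v) $ i = v $ i - (\<Sum>j<d. P i j * v $ j) + (\<Sum>j<d. w j * v $ j)"
    if v: "v \<in> carrier_vec d" and i: "i < d" for v i
  proof -
    have "(A *\<^sub>v v) $ i = (\<Sum>j<d. ((if i = j then 1 else 0) - P i j + w j) * v $ j)"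
      using v i A by (auto simp: A_def scalar_prod_def lessThan_atLeast0 intro!: sum.cong)
    also have "\<dots> = (\<Sum>j<d. (if i = j then v $ j else 0)) - (\<Sum>j<d. P i j * v $ j)
        + (\<Sum>j<d. w j * v $ j)"
      unfolding sum.distrib[symmetric] sum_subtractf[symmetric]
      by (intro sum.cong) (auto simp: algebra_simps)
    finally show ?thesis using i by simp
  qed
  have wAv: "(\<Sum>i<d. w i * (v i - (\<Sum>j<d. P i j * v j))) = 0" for v :: "nat \<Rightarrow> real"
  proof -
    have "(\<Sum>i<d. w i * (\<Sum>j<d. P i j * v j)) = (\<Sum>j<d. (\<Sum>i<d. w i * P i j) * v j)"
      unfolding sum_distrib_left sum_distrib_right by (subst sum.swap) (simp add: mult.assoc)
    also have "\<dots> = (\<Sum>j<d. w j * v j)" using w_stat by simp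
    finally show ?thesis by (simp add: right_diff_distrib sum_subtractf)
  qed
  have w_const: "(\<Sum>i<d. w i * v $ i) = (\<Sum>i<d. w i * (A *\<^sub>v v) $ i)"
    if v: "v \<in> carrier_vec d" for v
  proof -
    have "(\<Sum>i<d. w i * (A *\<^sub>v v) $ i)
      = (\<Sum>i<d. w i * (v $ i - (\<Sum>j<d. P i j * v $ j))) + (\<Sum>i<d. w i) * (\<Sum>j<d. w j * v $ j)"
      using Av[OF v] by (simp add: distrib_left sum.distrib sum_distrib_right)
    then show ?thesis using wAv[of "\<lambda>i. v $ i"] w_sum by simp
  qed
  have "det A \<noteq> 0"
  proof
    assume "det A = 0"
    then obtain v where v: "v \<in> carrier_vec d" "v \<noteq> 0\<^sub>v d" "A *\<^sub>v v = 0\<^sub>v d"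
      using det_0_iff_vec_prod_zero[OF A] by auto
    have w0: "(\<Sum>i<d. w i * v $ i) = 0" using w_const[OF v(1)] v(3) by simp
    have harm: "v $ i = (\<Sum>j<d. P i j * v $ j)" if "i < d" for i
      using Av[OF v(1) that] v(3) w0 that by simp
    have const: "v $ i = v $ 0" if "i < d" for i
      using irreducible_harmonic_const[OF st irr d harm, of i 0] that d by auto
    have "(\<Sum>i<d. w i * v $ i) = (\<Sum>i<d. w i * v $ 0)"
    proof (rule sum.cong[OF refl])
      fix i assume "i \<in> {..<d}"
      then have "v $ i = v $ 0" using const by blast
      then show "w i * v $ i = w i * v $ 0" by (rule arg_cong)
    qed
    also have "\<dots> = v $ 0" using w_sum by (simp add: sum_distrib_right[symmetric])
    finally have "(\<Sum>i<d. w i * v $ i) = v $ 0" .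
    then have "v $ 0 = 0" using w0 by linarith
    then have "v $ i = 0" if "i < d" for i using const[OF that] by linarith
    then have "v = 0\<^sub>v d" using v(1) by auto
    then show False using v(2) by simp
  qed
  from det_non_zero_imp_unit[OF A this, of "()"] obtain B where
    B: "B \<in> carrier_mat d d" "A * B = 1\<^sub>m d"
    unfolding Units_def by (auto simp: ring_mat_def)
  define v where "v = B *\<^sub>v vec d g"
  have v: "v \<in> carrier_vec d" unfolding v_def using B by simp
  have "A *\<^sub>v v = (A * B) *\<^sub>v vec d g"
    unfolding v_def using A B(1) by (simp add: assoc_mult_mat_vec[OF A B(1)])
  then have Ag: "A *\<^sub>v v = vec d g" using B by simp
  \<comment> \<open>Stationarity and total mass 1 give \<open>w A = w\<close>. So
    \<open>A v = g\<close> implies \<open>w v = w g = 0\<close>, and the rank-one term drops out of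
    the equation.\<close>
  have "(\<Sum>i<d. w i * v $ i) = 0" using w_const[OF v] g by (simp add: Ag)
  then show thesis using Av[OF v] Ag by (intro that[of "\<lambda>i. v $ i"]) simp
qed

section \<open>Markov additive processes\<close>

text \<open>The kernel identity is integrated over past events instead of being phrased with
  conditional expectations. The filtration is left general, so the reflected process
  \<open>- X\<close> fits over the same \<open>F\<close>. The law of \<open>X 0\<close> stays free;
  it is treated apart from the jumps.\<close>

locale markov_additive = prob_space M for M :: "'a measure" +
  fixes F :: "nat \<Rightarrow> 'a measure" and d :: nat
    and X :: "nat \<Rightarrow> 'a \<Rightarrow> real" and J :: "nat \<Rightarrow> 'a \<Rightarrow> nat"
    and \<mu> :: "nat \<Rightarrow> nat \<Rightarrow> real measure"
  assumes subalg: "subalgebra M (F n)"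
    and F_mono: "m \<le> n \<Longrightarrow> sets (F m) \<subseteq> sets (F n)"
    and X_adapted: "X n \<in> borel_measurable (F n)"
    and J_adapted: "J n \<in> measurable (F n) (count_space UNIV)"
    and J_less: "\<omega> \<in> space M \<Longrightarrow> J n \<omega> < d"
    and kernel_finite: "i < d \<Longrightarrow> j < d \<Longrightarrow> finite_measure (\<mu> i j)"
    and kernel_sets: "i < d \<Longrightarrow> j < d \<Longrightarrow> sets (\<mu> i j) = sets borel"
    and kernel_mass: "i < d \<Longrightarrow> (\<Sum>j<d. measure (\<mu> i j) UNIV) = 1"
    and kernel_moment: "i < d \<Longrightarrow> j < d \<Longrightarrow> integrable (\<mu> i j) (\<lambda>y. y)"
    and kernel: "A \<in> sets (F n) \<Longrightarrow> i < d \<Longrightarrow> j < d \<Longrightarrow>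
      prob (A \<inter> {\<omega>\<in>space M. J n \<omega> = i \<and> X (Suc n) \<omega> \<le> x \<and> J (Suc n) \<omega> = j})
      = prob (A \<inter> {\<omega>\<in>space M. J n \<omega> = i}) * measure (\<mu> i j) {..x}"
begin

lemma space_F: "space (F n) = space M"
  using subalg unfolding subalgebra_def by blast

lemma sets_F_M: "A \<in> sets (F n) \<Longrightarrow> A \<in> sets M"
  using subalg unfolding subalgebra_def by blast

lemma subalgebra_F: "m \<le> n \<Longrightarrow> subalgebra (F n) (F m)"
  using F_mono space_F by (simp add: subalgebra_def)

lemma measurable_F_M: "g \<in> measurable (F n) N \<Longrightarrow> g \<in> measurable M N"
  by (rule measurable_from_subalg[OF subalg])

lemma measurable_F_mono: "m \<le> n \<Longrightarrow> g \<in> measurable (F m) N \<Longrightarrow> g \<in> measurable (F n) N"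
  by (rule measurable_from_subalg[OF subalgebra_F])

lemma X_M [measurable]: "X n \<in> borel_measurable M"
  by (rule measurable_F_M[OF X_adapted])

lemma J_M [measurable]: "J n \<in> measurable M (count_space UNIV)"
  by (rule measurable_F_M[OF J_adapted])

lemma kernel_integrable_bounded:
  assumes "i < d" "j < d" "f \<in> borel_measurable borel" "\<And>y. \<bar>f y\<bar> \<le> (b::real)"
  shows "integrable (\<mu> i j) f"
proof -
  interpret finite_measure "\<mu> i j" using kernel_finite assms by simp
  show ?thesis
    by (rule integrable_const_bound[of _ b])
      (use assms in \<open>auto simp: measurable_cong_sets[OF kernel_sets[OF assms(1,2)] refl]\<close>)
qed

lemma kernel_integral:
  assumes A: "A \<in> sets (F n)" and i: "i < d" and j: "j < d"
    and [measurable]: "f \<in> borel_measurable borel"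
  shows "(\<integral>\<omega>. indicator (A \<inter> {\<omega>\<in>space M. J n \<omega> = i \<and> J (Suc n) \<omega> = j}) \<omega> * f (X (Suc n) \<omega>) \<partial>M)
    = prob (A \<inter> {\<omega>\<in>space M. J n \<omega> = i}) * (\<integral>y. f y \<partial>\<mu> i j)"
proof -
  interpret \<mu>: finite_measure "\<mu> i j" using kernel_finite i j by simp
  note [measurable_cong] = kernel_sets[OF i j]
  have [measurable]: "A \<in> sets M" using sets_F_M A .
  define E where "E = A \<inter> {\<omega>\<in>space M. J n \<omega> = i \<and> J (Suc n) \<omega> = j}"
  have [measurable]: "E \<in> sets M" unfolding E_def by measurable
  define p where "p = prob (A \<inter> {\<omega>\<in>space M. J n \<omega> = i})"
  \<comment> \<open>Both sides are finite measures on the line, and \<open>kernel\<close> says that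
    their distribution functions agree. Equality as measures gives the claim for every measurable
    \<open>f\<close>; for a nonintegrable one both sides are 0.\<close>
  have eq: "distr (density M (\<lambda>\<omega>. ennreal (indicator E \<omega>))) borel (X (Suc n))
    = density (\<mu> i j) (\<lambda>_. ennreal p)" (is "?L = ?R")
  proof (rule cdf_unique')
    have L: "emeasure ?L B = emeasure M (E \<inter> (X (Suc n) -` B \<inter> space M))"
      if [measurable]: "B \<in> sets borel" for B
    proof -
      have "emeasure ?L B = emeasure (density M (\<lambda>\<omega>. ennreal (indicator E \<omega>))) (X (Suc n) -` B \<inter> space M)"
        by (subst emeasure_distr) auto
      also have "\<dots> = (\<integral>\<^sup>+\<omega>. indicator (E \<inter> (X (Suc n) -` B \<inter> space M)) \<omega> \<partial>M)"
      proof (subst emeasure_density)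
        show "(\<integral>\<^sup>+\<omega>\<in>X (Suc n) -` B \<inter> space M. ennreal (indicator E \<omega>) \<partial>M)
          = (\<integral>\<^sup>+\<omega>. indicator (E \<inter> (X (Suc n) -` B \<inter> space M)) \<omega> \<partial>M)"
          by (intro nn_integral_cong) (simp split: split_indicator)
      qed auto
      also have "\<dots> = emeasure M (E \<inter> (X (Suc n) -` B \<inter> space M))"
        by (subst nn_integral_indicator) auto
      finally show ?thesis .
    qed
    have R: "emeasure ?R B = ennreal (p * measure (\<mu> i j) B)" if [measurable]: "B \<in> sets borel" for B
      by (subst emeasure_density)
        (auto simp: nn_integral_cmult \<mu>.emeasure_eq_measure ennreal_mult p_def)
    show "finite_borel_measure ?L"
      unfolding finite_borel_measure_def finite_borel_measure_axioms_def
      using L[of UNIV] by (auto intro!: finite_measureI simp: emeasure_eq_measure)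
    show "finite_borel_measure ?R"
      unfolding finite_borel_measure_def finite_borel_measure_axioms_def
      using R[of UNIV] sets_eq_imp_space_eq[OF kernel_sets[OF i j]]
      by (auto intro!: finite_measureI simp: kernel_sets[OF i j])
    show "cdf ?L = cdf ?R"
    proof
      fix x
      have "E \<inter> (X (Suc n) -` {..x} \<inter> space M)
        = A \<inter> {\<omega>\<in>space M. J n \<omega> = i \<and> X (Suc n) \<omega> \<le> x \<and> J (Suc n) \<omega> = j}"
        unfolding E_def by auto
      then have "emeasure ?L {..x} = ennreal (p * measure (\<mu> i j) {..x})"
        unfolding p_def by (simp add: L emeasure_eq_measure kernel[OF A i j])
      also have "\<dots> = emeasure ?R {..x}" by (simp add: R)
      finally show "cdf ?L x = cdf ?R x" unfolding cdf_def2 measure_def by simp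
    qed
  qed
  have "(\<integral>\<omega>. indicator E \<omega> * f (X (Suc n) \<omega>) \<partial>M)
    = (\<integral>\<omega>. f (X (Suc n) \<omega>) \<partial>density M (\<lambda>\<omega>. ennreal (indicator E \<omega>)))"
    by (subst integral_density) auto
  also have "\<dots> = (\<integral>y. f y \<partial>?L)" by (subst integral_distr) auto
  also have "\<dots> = p * (\<integral>y. f y \<partial>\<mu> i j)" unfolding eq by (subst integral_density) (auto simp: p_def)
  finally show ?thesis unfolding E_def p_def .
qed

text \<open>The Markov property tested against bounded past variables \<open>G\<close>. Splitting
  over the finitely many pairs of consecutive states reduces it to \<open>kernel_integral\<close>.
  Boundedness makes everything integrable, which is one reason to truncate the jumps.\<close>

lemma transition_expectation:
  fixes \<phi> :: "nat \<Rightarrow> real \<Rightarrow> nat \<Rightarrow> real"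
  assumes \<phi> [measurable]: "\<And>i j. (\<lambda>y. \<phi> i y j) \<in> borel_measurable borel"
    and \<phi>_bd: "\<And>i y j. i < d \<Longrightarrow> j < d \<Longrightarrow> \<bar>\<phi> i y j\<bar> \<le> b"
    and G: "G \<in> borel_measurable (F n)" and G_bd: "\<And>\<omega>. \<omega> \<in> space M \<Longrightarrow> \<bar>G \<omega>\<bar> \<le> c"
  shows "(\<integral>\<omega>. G \<omega> * \<phi> (J n \<omega>) (X (Suc n) \<omega>) (J (Suc n) \<omega>) \<partial>M)
    = (\<integral>\<omega>. G \<omega> * (\<Sum>j<d. \<integral>y. \<phi> (J n \<omega>) y j \<partial>\<mu> (J n \<omega>) j) \<partial>M)"
proof -
  have "finite_measure_subalgebra M (F n)"
    using subalg by unfold_locales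
  then interpret S: sigma_finite_subalgebra M "F n"
    by (rule finite_measure_subalgebra_is_sigma_finite)
  define \<Phi> where "\<Phi> i = (\<Sum>j<d. \<integral>y. \<phi> i y j \<partial>\<mu> i j)" for i
  define Y where "Y \<omega> = \<phi> (J n \<omega>) (X (Suc n) \<omega>) (J (Suc n) \<omega>)" for \<omega>
  have [measurable]: "Y \<in> borel_measurable M" unfolding Y_def by measurable
  have [measurable]: "G \<in> borel_measurable M" by (rule measurable_F_M[OF G])
  have Y_bd: "\<bar>Y \<omega>\<bar> \<le> b" if "\<omega> \<in> space M" for \<omega>
    unfolding Y_def using \<phi>_bd J_less that by auto
  have [simp]: "integrable M Y" using Y_bd by (intro integrable_const_bound[of _ b]) auto
  have \<Phi>_bd: "\<bar>\<Phi> (J n \<omega>)\<bar> \<le> (\<Sum>i<d. \<bar>\<Phi> i\<bar>)" if "\<omega> \<in> space M" for \<omega>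
    using J_less[OF that] by (intro member_le_sum) auto
  have \<Phi>_meas: "(\<lambda>\<omega>. \<Phi> (J n \<omega>)) \<in> borel_measurable (F n)"
    using J_adapted by measurable
  then have [measurable]: "(\<lambda>\<omega>. \<Phi> (J n \<omega>)) \<in> borel_measurable M" by (rule measurable_F_M)
  have [simp]: "integrable M (\<lambda>\<omega>. \<Phi> (J n \<omega>))"
    using \<Phi>_bd by (intro integrable_const_bound[of _ "\<Sum>i<d. \<bar>\<Phi> i\<bar>"]) auto
  have "AE \<omega> in M. real_cond_exp M (F n) Y \<omega> = \<Phi> (J n \<omega>)"
  proof (rule S.real_cond_exp_charact)
    fix A assume A: "A \<in> sets (F n)"
    then have [measurable]: "A \<in> sets M" by (rule sets_F_M)
    define E where "E i j = A \<inter> {\<omega>\<in>space M. J n \<omega> = i \<and> J (Suc n) \<omega> = j}" for i j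
    have [measurable]: "E i j \<in> sets M" for i j unfolding E_def by measurable
    have Yint: "integrable M (\<lambda>\<omega>. indicator (E i j) \<omega> * \<phi> i (X (Suc n) \<omega>) j)" if "i < d" "j < d" for i j
      using \<phi>_bd[OF that] that order_trans[OF abs_ge_zero \<phi>_bd]
      by (intro integrable_const_bound[of _ b]) (auto simp: indicator_def)
    have "(\<integral>\<omega>\<in>A. Y \<omega> \<partial>M)
      = (\<integral>\<omega>. (\<Sum>i<d. \<Sum>j<d. indicator (E i j) \<omega> * \<phi> i (X (Suc n) \<omega>) j) \<partial>M)"
      unfolding set_lebesgue_integral_def
    proof (rule Bochner_Integration.integral_cong[OF refl])
      fix \<omega> assume \<omega>: "\<omega> \<in> space M"
      have *: "indicator (E i j) \<omega> * \<phi> i (X (Suc n) \<omega>) j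
        = (if j = J (Suc n) \<omega> then if i = J n \<omega> then indicator A \<omega> * Y \<omega> else 0 else 0)" for i j
        using \<omega> by (auto simp: E_def Y_def indicator_def)
      show "indicator A \<omega> *\<^sub>R Y \<omega> = (\<Sum>i<d. \<Sum>j<d. indicator (E i j) \<omega> * \<phi> i (X (Suc n) \<omega>) j)"
        unfolding * using J_less[OF \<omega>] by simp
    qed
    also have "\<dots> = (\<Sum>i<d. \<Sum>j<d. prob (A \<inter> {\<omega>\<in>space M. J n \<omega> = i}) * (\<integral>y. \<phi> i y j \<partial>\<mu> i j))"
    proof (subst Bochner_Integration.integral_sum)
      show "integrable M (\<lambda>\<omega>. \<Sum>j<d. indicator (E i j) \<omega> * \<phi> i (X (Suc n) \<omega>) j)" if "i \<in> {..<d}" for i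
        using that by (intro Bochner_Integration.integrable_sum Yint) auto
      show "(\<Sum>i<d. \<integral>\<omega>. (\<Sum>j<d. indicator (E i j) \<omega> * \<phi> i (X (Suc n) \<omega>) j) \<partial>M)
        = (\<Sum>i<d. \<Sum>j<d. prob (A \<inter> {\<omega>\<in>space M. J n \<omega> = i}) * (\<integral>y. \<phi> i y j \<partial>\<mu> i j))"
      proof (intro sum.cong refl)
        fix i assume i: "i \<in> {..<d}"
        have "(\<integral>\<omega>. (\<Sum>j<d. indicator (E i j) \<omega> * \<phi> i (X (Suc n) \<omega>) j) \<partial>M)
          = (\<Sum>j<d. \<integral>\<omega>. indicator (E i j) \<omega> * \<phi> i (X (Suc n) \<omega>) j \<partial>M)"
          using i by (intro Bochner_Integration.integral_sum Yint) auto
        also have "\<dots> = (\<Sum>j<d. prob (A \<inter> {\<omega>\<in>space M. J n \<omega> = i}) * (\<integral>y. \<phi> i y j \<partial>\<mu> i j))"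
        proof (rule sum.cong[OF refl])
          fix j assume "j \<in> {..<d}"
          then show "(\<integral>\<omega>. indicator (E i j) \<omega> * \<phi> i (X (Suc n) \<omega>) j \<partial>M)
            = prob (A \<inter> {\<omega>\<in>space M. J n \<omega> = i}) * (\<integral>y. \<phi> i y j \<partial>\<mu> i j)"
            unfolding E_def using i by (intro kernel_integral A) auto
        qed
        finally show "(\<integral>\<omega>. (\<Sum>j<d. indicator (E i j) \<omega> * \<phi> i (X (Suc n) \<omega>) j) \<partial>M)
          = (\<Sum>j<d. prob (A \<inter> {\<omega>\<in>space M. J n \<omega> = i}) * (\<integral>y. \<phi> i y j \<partial>\<mu> i j))" .
      qed
    qed
    also have "\<dots> = (\<Sum>i<d. (\<integral>\<omega>. indicator (A \<inter> {\<omega>\<in>space M. J n \<omega> = i}) \<omega> * \<Phi> i \<partial>M))"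
      by (intro sum.cong refl) (simp add: \<Phi>_def[symmetric] sum_distrib_left[symmetric])
    also have "\<dots> = (\<integral>\<omega>. (\<Sum>i<d. indicator (A \<inter> {\<omega>\<in>space M. J n \<omega> = i}) \<omega> * \<Phi> i) \<partial>M)"
      by (intro Bochner_Integration.integral_sum[symmetric] integrable_mult_left integrable_real_indicator)
        (auto simp: emeasure_eq_measure)
    also have "\<dots> = (\<integral>\<omega>\<in>A. \<Phi> (J n \<omega>) \<partial>M)"
      unfolding set_lebesgue_integral_def
    proof (rule Bochner_Integration.integral_cong[OF refl])
      fix \<omega> assume \<omega>: "\<omega> \<in> space M"
      have *: "indicator (A \<inter> {\<omega>\<in>space M. J n \<omega> = i}) \<omega> * \<Phi> i
        = (if i = J n \<omega> then indicator A \<omega> * \<Phi> (J n \<omega>) else 0)" for i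
        using \<omega> by (auto simp: indicator_def)
      show "(\<Sum>i<d. indicator (A \<inter> {\<omega>\<in>space M. J n \<omega> = i}) \<omega> * \<Phi> i) = indicator A \<omega> *\<^sub>R \<Phi> (J n \<omega>)"
        unfolding * using J_less[OF \<omega>] by simp
    qed
    finally show "(\<integral>\<omega>\<in>A. Y \<omega> \<partial>M) = (\<integral>\<omega>\<in>A. \<Phi> (J n \<omega>) \<partial>M)" .
  qed (use \<Phi>_meas in auto)
  then have ae: "AE \<omega> in M. G \<omega> * real_cond_exp M (F n) Y \<omega> = G \<omega> * \<Phi> (J n \<omega>)" by auto
  have GY: "integrable M (\<lambda>\<omega>. G \<omega> * Y \<omega>)"
  proof (rule integrable_const_bound[of _ "c * b"])
    show "AE \<omega> in M. norm (G \<omega> * Y \<omega>) \<le> c * b"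
      using G_bd Y_bd by (intro AE_I2) (auto simp: abs_mult intro!: mult_mono order_trans[OF abs_ge_zero G_bd])
  qed measurable
  have "(\<integral>\<omega>. G \<omega> * Y \<omega> \<partial>M) = (\<integral>\<omega>. G \<omega> * real_cond_exp M (F n) Y \<omega> \<partial>M)"
    using S.real_cond_exp_intg(2)[OF GY G] by simp
  also have "\<dots> = (\<integral>\<omega>. G \<omega> * \<Phi> (J n \<omega>) \<partial>M)"
    by (rule integral_cong_AE) (use ae in auto)
  finally show ?thesis unfolding Y_def \<Phi>_def .
qed

text \<open>Kolmogorov's inequality on an event \<open>A\<close> of the past. Stopping lets the
  second moment at the single time \<open>n\<close> control the whole maximum; by orthogonality each
  step adds at most \<open>v * prob A\<close> to it, and Chebyshev's inequality concludes.\<close>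

lemma martingale_maximal_inequality:
  fixes D :: "nat \<Rightarrow> 'a \<Rightarrow> real"
  assumes D_meas: "\<And>k. D k \<in> borel_measurable (F (Suc k))"
    and D_bd: "\<And>k \<omega>. \<omega> \<in> space M \<Longrightarrow> \<bar>D k \<omega>\<bar> \<le> b"
    and mart: "\<And>k G c. G \<in> borel_measurable (F k) \<Longrightarrow> (\<And>\<omega>. \<omega> \<in> space M \<Longrightarrow> \<bar>G \<omega>\<bar> \<le> c) \<Longrightarrow>
      (\<integral>\<omega>. G \<omega> * D k \<omega> \<partial>M) = 0"
    and var: "\<And>k B. B \<in> sets (F k) \<Longrightarrow> (\<integral>\<omega>. indicator B \<omega> * (D k \<omega>)\<^sup>2 \<partial>M) \<le> v * prob B"
    and v: "v \<ge> 0" and A: "A \<in> sets (F m)" and a: "a > 0" and mn: "m \<le> n"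
  shows "prob (A \<inter> {\<omega>\<in>space M. \<exists>k\<in>{m..n}. a \<le> (\<Sum>l=m..<k. D l \<omega>)})
    \<le> real (n - m) * v * prob A / a\<^sup>2"
proof -
  have b: "b \<ge> 0" using not_empty order_trans[OF abs_ge_zero D_bd] by blast
  define R where "R k \<omega> = (\<Sum>l=m..<k. D l \<omega>)" for k \<omega>
  \<comment> \<open>\<open>U\<close> is \<open>R\<close> stopped when it first reaches \<open>a\<close>.\<close>
  define alive where "alive k = A \<inter> {\<omega>\<in>space M. \<forall>l\<in>{m..k}. R l \<omega> < a}" for k
  define U where "U k \<omega> = (\<Sum>l=m..<k. indicator (alive l) \<omega> * D l \<omega>)" for k \<omega>
  have R_F: "R k \<in> borel_measurable (F k)" for k
    unfolding R_def by (intro borel_measurable_sum measurable_F_mono[OF _ D_meas]) auto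
  have alive_F: "alive k \<in> sets (F k)" if "m \<le> k" for k
    using that
  proof (induction rule: dec_induct)
    case base
    have "alive m = A"
      using sets.sets_into_space[OF A] a by (auto simp: alive_def R_def space_F)
    then show ?case using A by simp
  next
    case (step k)
    have "alive (Suc k) = alive k \<inter> {\<omega>\<in>space (F (Suc k)). R (Suc k) \<omega> < a}"
      using step.hyps by (auto simp: alive_def atLeastAtMostSuc_conv space_F)
    also have "\<dots> \<in> sets (F (Suc k))"
      using F_mono[of k "Suc k"] step.IH R_F[of "Suc k"] by (intro sets.Int) auto
    finally show ?case .
  qed
  have U_F: "U k \<in> borel_measurable (F k)" for k
    unfolding U_def
  proof (intro borel_measurable_sum borel_measurable_times)
    fix l assume l: "l \<in> {m..<k}"
    have "alive l \<in> sets (F k)" using alive_F[of l] F_mono[of l k] l by auto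
    then show "indicat_real (alive l) \<in> borel_measurable (F k)" by simp
    show "D l \<in> borel_measurable (F k)" using l by (intro measurable_F_mono[OF _ D_meas]) auto
  qed
  have U_bd: "\<bar>U k \<omega>\<bar> \<le> real (k - m) * b" if "\<omega> \<in> space M" for k \<omega>
  proof -
    have "\<bar>U k \<omega>\<bar> \<le> (\<Sum>l=m..<k. b)" unfolding U_def
      using order_trans[OF abs_ge_zero D_bd[OF that]] D_bd[OF that]
      by (intro order_trans[OF sum_abs] sum_mono) (auto simp: indicator_def)
    then show ?thesis by simp
  qed
  note [measurable] = measurable_F_M[OF U_F] measurable_F_M[OF D_meas]
  have U2_int: "integrable M (\<lambda>\<omega>. (U k \<omega>)\<^sup>2)" for k
    using U_bd[of _ k] power_mono[OF U_bd[of _ k] abs_ge_zero, of _ 2]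
    by (intro integrable_const_bound[of _ "(real (k - m) * b)\<^sup>2"]) auto
  have EU: "(\<integral>\<omega>. (U k \<omega>)\<^sup>2 \<partial>M) \<le> real (k - m) * v * prob A" if "m \<le> k" for k
    using that
  proof (induction rule: dec_induct)
    case base
    then show ?case by (simp add: U_def)
  next
    case (step k)
    note alive_F = alive_F[OF \<open>m \<le> k\<close>]
    have [measurable]: "alive k \<in> sets M" by (rule sets_F_M[OF alive_F])
    have bound: "\<bar>2 * U k \<omega> * indicator (alive k) \<omega>\<bar> \<le> 2 * (real (k - m) * b)" if "\<omega> \<in> space M" for \<omega>
      using U_bd[OF that, of k] by (auto simp: indicator_def abs_mult)
    \<comment> \<open>The stopped sum and the event of not having stopped are both known at time
      \<open>k\<close>, so their product is an admissible test variable.\<close>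
    have cross: "(\<integral>\<omega>. (2 * U k \<omega> * indicator (alive k) \<omega>) * D k \<omega> \<partial>M) = 0"
      by (rule mart[OF _ bound]) (use U_F alive_F in measurable)
    have int1: "integrable M (\<lambda>\<omega>. (2 * U k \<omega> * indicator (alive k) \<omega>) * D k \<omega>)"
    proof (rule integrable_const_bound[of _ "2 * (real (k - m) * b) * b"])
      show "AE \<omega> in M. norm ((2 * U k \<omega> * indicator (alive k) \<omega>) * D k \<omega>) \<le> 2 * (real (k - m) * b) * b"
        unfolding real_norm_def abs_mult[of _ "D k _"]
        using bound D_bd b by (intro AE_I2 mult_mono) auto
    qed measurable
    have int2: "integrable M (\<lambda>\<omega>. indicator (alive k) \<omega> * (D k \<omega>)\<^sup>2)"
    proof (rule integrable_const_bound[of _ "b\<^sup>2"])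
      show "AE \<omega> in M. norm (indicator (alive k) \<omega> * (D k \<omega>)\<^sup>2) \<le> b\<^sup>2"
        using power_mono[OF D_bd abs_ge_zero, of _ k 2] by (intro AE_I2) (auto simp: indicator_def)
    qed measurable
    have "(\<integral>\<omega>. (U (Suc k) \<omega>)\<^sup>2 \<partial>M) = (\<integral>\<omega>. (U k \<omega>)\<^sup>2
      + (2 * U k \<omega> * indicator (alive k) \<omega>) * D k \<omega> + indicator (alive k) \<omega> * (D k \<omega>)\<^sup>2 \<partial>M)"
      using step.hyps
      by (intro Bochner_Integration.integral_cong) (auto simp: U_def power2_eq_square indicator_def algebra_simps)
    also have "\<dots> = (\<integral>\<omega>. (U k \<omega>)\<^sup>2 \<partial>M) + (\<integral>\<omega>. indicator (alive k) \<omega> * (D k \<omega>)\<^sup>2 \<partial>M)"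
      using U2_int int1 int2 cross
      by (subst Bochner_Integration.integral_add, simp, simp)+ simp
    also have "\<dots> \<le> real (k - m) * v * prob A + v * prob (alive k)"
      by (intro add_mono step.IH var alive_F)
    also have "\<dots> \<le> real (k - m) * v * prob A + v * prob A"
      using v sets_F_M[OF A]
      by (intro add_left_mono mult_left_mono finite_measure_mono) (auto simp: alive_def)
    also have "\<dots> = real (Suc k - m) * v * prob A"
      using step.hyps by (simp add: Suc_diff_le algebra_simps)
    finally show ?case .
  qed
  have stopped: "(\<omega> \<in> alive k \<longrightarrow> U k \<omega> = R k \<omega>) \<and> (\<omega> \<notin> alive k \<longrightarrow> a \<le> U k \<omega>)"
    if "m \<le> k" "\<omega> \<in> A" for k \<omega>
    using that(1)
  proof (induction rule: dec_induct)
    case base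
    then show ?case using that(2) a sets.sets_into_space[OF A]
      by (auto simp: alive_def R_def U_def space_F)
  next
    case (step k)
    have "U (Suc k) \<omega> = U k \<omega> + indicator (alive k) \<omega> * D k \<omega>" "R (Suc k) \<omega> = R k \<omega> + D k \<omega>"
      using step.hyps by (simp_all add: U_def R_def)
    moreover have "\<omega> \<in> alive (Suc k) \<longleftrightarrow> \<omega> \<in> alive k \<and> R (Suc k) \<omega> < a"
      using step.hyps by (auto simp: alive_def atLeastAtMostSuc_conv)
    ultimately show ?case using step.IH by (cases "\<omega> \<in> alive k") auto
  qed
  have "prob (A \<inter> {\<omega>\<in>space M. \<exists>k\<in>{m..n}. a \<le> (\<Sum>l=m..<k. D l \<omega>)})
    \<le> prob {\<omega>\<in>space M. a\<^sup>2 \<le> (U n \<omega>)\<^sup>2}"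
  proof (rule finite_measure_mono)
    show "A \<inter> {\<omega>\<in>space M. \<exists>k\<in>{m..n}. a \<le> (\<Sum>l=m..<k. D l \<omega>)} \<subseteq> {\<omega>\<in>space M. a\<^sup>2 \<le> (U n \<omega>)\<^sup>2}"
    proof
      fix \<omega> assume *: "\<omega> \<in> A \<inter> {\<omega>\<in>space M. \<exists>k\<in>{m..n}. a \<le> (\<Sum>l=m..<k. D l \<omega>)}"
      then have "\<omega> \<notin> alive n" by (auto simp: alive_def R_def not_less)
      then have "a \<le> U n \<omega>" using stopped[OF mn] * by auto
      then show "\<omega> \<in> {\<omega>\<in>space M. a\<^sup>2 \<le> (U n \<omega>)\<^sup>2}" using * a by (auto intro: power_mono)
    qed
  qed measurable
  also have "\<dots> \<le> (\<integral>\<omega>. (U n \<omega>)\<^sup>2 \<partial>M) / a\<^sup>2"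
    using a U2_int by (intro integral_Markov_inequality_measure[where A = "{}"]) auto
  also have "\<dots> \<le> real (n - m) * v * prob A / a\<^sup>2"
    using EU[OF mn] by (intro divide_right_mono) auto
  finally show ?thesis .
qed

end

section \<open>Truncation\<close>

definition trunc :: "real \<Rightarrow> real \<Rightarrow> real" where
  "trunc z y = (if \<bar>y\<bar> \<le> z then y else 0)"

lemma trunc_measurable [measurable]: "trunc z \<in> borel_measurable borel"
  unfolding trunc_def by measurable

lemma abs_trunc_le: "\<bar>trunc z y\<bar> \<le> \<bar>y\<bar>" "\<bar>trunc z y\<bar> \<le> \<bar>z\<bar>"
  by (auto simp: trunc_def)

text \<open>Dominated convergence with \<open>\<bar>y\<bar>\<close> in all three cases. In the
  second, one factor of the square is at most \<open>\<bar>y\<bar>\<close> and the other at most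
  \<open>z\<close>; this limit takes the place of a finite variance.\<close>

lemma trunc_moments:
  assumes "finite_measure N" and sets: "sets N = sets borel" and int: "integrable N (\<lambda>y. y)"
  shows "((\<lambda>z. \<integral>y. trunc z y \<partial>N) \<longlongrightarrow> (\<integral>y. y \<partial>N)) at_top"
    and "((\<lambda>z. (\<integral>y. (trunc z y)\<^sup>2 \<partial>N) / z) \<longlongrightarrow> 0) at_top"
    and "((\<lambda>z. z * measure N {y. z < \<bar>y\<bar>}) \<longlongrightarrow> 0) at_top"
proof -
  interpret finite_measure N by fact
  have meas: "g \<in> borel_measurable borel \<Longrightarrow> g \<in> borel_measurable N" for g :: "real \<Rightarrow> real"
    by (simp add: measurable_cong_sets[OF sets refl])
  have abs: "integrable N (\<lambda>y. \<bar>y\<bar>)" using int by (rule integrable_abs)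
  have space: "space N = UNIV" using sets_eq_imp_space_eq[OF sets] by simp
  have ev: "\<forall>\<^sub>F z in at_top. \<bar>y\<bar> \<le> z \<and> 0 < z" for y :: real
    using eventually_ge_at_top[of "\<bar>y\<bar>"] eventually_gt_at_top[of 0] by eventually_elim simp
  show "((\<lambda>z. \<integral>y. trunc z y \<partial>N) \<longlongrightarrow> (\<integral>y. y \<partial>N)) at_top"
  proof (rule integral_dominated_convergence_at_top[where w = "\<lambda>y. \<bar>y\<bar>"])
    show "AE y in N. ((\<lambda>z. trunc z y) \<longlongrightarrow> y) at_top"
    proof (rule AE_I2)
      fix y :: real
      show "((\<lambda>z. trunc z y) \<longlongrightarrow> y) at_top"
        by (rule tendsto_eventually, rule eventually_mono[OF ev[of y]]) (auto simp: trunc_def)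
    qed
    show "\<forall>\<^sub>F z in at_top. AE y in N. norm (trunc z y) \<le> \<bar>y\<bar>"
      by (intro always_eventually allI AE_I2) (simp add: abs_trunc_le)
  qed (use abs in \<open>auto intro!: meas\<close>)
  have "((\<lambda>z. \<integral>y. (trunc z y)\<^sup>2 / z \<partial>N) \<longlongrightarrow> (\<integral>y. 0 \<partial>N)) at_top"
  proof (rule integral_dominated_convergence_at_top[where w = "\<lambda>y. \<bar>y\<bar>"])
    show "AE y in N. ((\<lambda>z. (trunc z y)\<^sup>2 / z) \<longlongrightarrow> 0) at_top"
    proof (rule AE_I2)
      fix y :: real
      have "((\<lambda>z. y\<^sup>2 / z) \<longlongrightarrow> 0) at_top"
        by (rule tendsto_divide_0[OF tendsto_const filterlim_at_top_imp_at_infinity[OF filterlim_ident]])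
      then show "((\<lambda>z. (trunc z y)\<^sup>2 / z) \<longlongrightarrow> 0) at_top"
        by (rule Lim_transform_eventually) (rule eventually_mono[OF ev[of y]], auto simp: trunc_def)
    qed
    show "\<forall>\<^sub>F z in at_top. AE y in N. norm ((trunc z y)\<^sup>2 / z) \<le> \<bar>y\<bar>"
    proof (rule eventually_mono[OF ev[of 0]], rule AE_I2)
      fix z y :: real assume z: "\<bar>0\<bar> \<le> z \<and> 0 < z"
      have "(trunc z y)\<^sup>2 \<le> \<bar>y\<bar> * z"
        using abs_trunc_le[of z y] z unfolding power2_eq_square abs_mult_self_eq[symmetric, of "trunc z y"]
        by (intro mult_mono) auto
      then show "norm ((trunc z y)\<^sup>2 / z) \<le> \<bar>y\<bar>" using z by (simp add: field_simps)
    qed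
  qed (use abs in \<open>auto intro!: meas\<close>)
  then show "((\<lambda>z. (\<integral>y. (trunc z y)\<^sup>2 \<partial>N) / z) \<longlongrightarrow> 0) at_top" by simp
  have "((\<lambda>z. \<integral>y. z * indicator {y. z < \<bar>y\<bar>} y \<partial>N) \<longlongrightarrow> (\<integral>y. 0 \<partial>N)) at_top"
  proof (rule integral_dominated_convergence_at_top[where w = "\<lambda>y. \<bar>y\<bar>"])
    show "AE y in N. ((\<lambda>z. z * indicator {y. z < \<bar>y\<bar>} y) \<longlongrightarrow> 0) at_top"
    proof (rule AE_I2)
      fix y :: real
      show "((\<lambda>z. z * indicator {y. z < \<bar>y\<bar>} y) \<longlongrightarrow> 0) at_top"
        by (rule tendsto_eventually, rule eventually_mono[OF ev[of y]]) auto
    qed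
    show "\<forall>\<^sub>F z in at_top. AE y in N. norm (z * indicator {y. z < \<bar>y\<bar>} y) \<le> \<bar>y\<bar>"
      by (rule eventually_mono[OF ev[of 0]]) (auto simp: indicator_def)
  qed (use abs in \<open>auto intro!: meas\<close>)
  then show "((\<lambda>z. z * measure N {y. z < \<bar>y\<bar>}) \<longlongrightarrow> 0) at_top"
    by (simp add: space)
qed

section \<open>Conditional bounds for one jump and for a block of jumps\<close>

context markov_additive
begin

text \<open>The sum over all entries dominates the jump tail out of each state, uniformly in the
  current state, and being finite it stays \<open>o(Q)\<close> when the entries are.\<close>

definition jump_tail :: "real \<Rightarrow> real" where
  "jump_tail z = (\<Sum>i<d. \<Sum>j<d. measure (\<mu> i j) {y. z < \<bar>y\<bar>})"

lemma jump_tail_nonneg: "jump_tail z \<ge> 0"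
  unfolding jump_tail_def by (intro sum_nonneg) auto

lemma kernel_space: "i < d \<Longrightarrow> j < d \<Longrightarrow> space (\<mu> i j) = UNIV"
  using sets_eq_imp_space_eq[OF kernel_sets] by simp

lemma row_sum_le:
  fixes a :: "nat \<Rightarrow> nat \<Rightarrow> real"
  assumes "\<And>i j. i < d \<Longrightarrow> j < d \<Longrightarrow> 0 \<le> a i j" "i < d"
  shows "(\<Sum>j<d. a i j) \<le> (\<Sum>i<d. \<Sum>j<d. a i j)"
  by (rule member_le_sum[of i "{..<d}" "\<lambda>i. \<Sum>j<d. a i j"]) (use assms in \<open>auto intro!: sum_nonneg\<close>)

lemma transition_bound:
  fixes \<phi> :: "real \<Rightarrow> real"
  assumes \<phi>: "\<phi> \<in> borel_measurable borel" "\<And>y. 0 \<le> \<phi> y" "\<And>y. \<phi> y \<le> b"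
    and A: "A \<in> sets (F n)" and C: "\<And>i. i < d \<Longrightarrow> (\<Sum>j<d. \<integral>y. \<phi> y \<partial>\<mu> i j) \<le> C"
  shows "(\<integral>\<omega>. indicator A \<omega> * \<phi> (X (Suc n) \<omega>) \<partial>M) \<le> C * prob A"
proof -
  have [measurable]: "A \<in> sets M" by (rule sets_F_M[OF A])
  have [measurable]: "(\<lambda>\<omega>. \<Sum>j<d. \<integral>y. \<phi> y \<partial>\<mu> (J n \<omega>) j) \<in> borel_measurable M"
    by (rule measurable_compose[OF J_M, of "\<lambda>i. \<Sum>j<d. \<integral>y. \<phi> y \<partial>\<mu> i j" borel]) simp
  have "(\<integral>\<omega>. indicator A \<omega> * \<phi> (X (Suc n) \<omega>) \<partial>M)
    = (\<integral>\<omega>. indicator A \<omega> * (\<Sum>j<d. \<integral>y. \<phi> y \<partial>\<mu> (J n \<omega>) j) \<partial>M)"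
    by (rule transition_expectation[where \<phi> = "\<lambda>_ y _. \<phi> y" and b = b and c = 1])
      (use A \<phi> in \<open>auto simp: indicator_def\<close>)
  also have "\<dots> \<le> (\<integral>\<omega>. indicator A \<omega> * C \<partial>M)"
  proof (rule integral_mono)
    show "integrable M (\<lambda>\<omega>. indicator A \<omega> * (\<Sum>j<d. \<integral>y. \<phi> y \<partial>\<mu> (J n \<omega>) j))"
    proof (rule integrable_const_bound[of _ C])
      show "AE \<omega> in M. norm (indicator A \<omega> * (\<Sum>j<d. \<integral>y. \<phi> y \<partial>\<mu> (J n \<omega>) j)) \<le> C"
        using \<phi>(2) C[OF J_less]
        by (intro AE_I2) (auto simp: indicator_def abs_of_nonneg sum_nonneg intro: order_trans[OF _ C[OF J_less]])
    qed measurable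
    show "integrable M (\<lambda>\<omega>. indicator A \<omega> * C)"
      by (intro integrable_mult_left integrable_real_indicator) (auto simp: emeasure_eq_measure)
    show "indicator A \<omega> * (\<Sum>j<d. \<integral>y. \<phi> y \<partial>\<mu> (J n \<omega>) j) \<le> indicator A \<omega> * C" if "\<omega> \<in> space M" for \<omega>
      using C[OF J_less[OF that]] by (intro mult_left_mono) auto
  qed
  also have "\<dots> = C * prob A" by simp
  finally show ?thesis .
qed

lemma jump_bound:
  assumes A: "A \<in> sets (F n)"
  shows "prob (A \<inter> {\<omega>\<in>space M. z < \<bar>X (Suc n) \<omega>\<bar>}) \<le> jump_tail z * prob A"
proof -
  have [measurable]: "A \<in> sets M" by (rule sets_F_M[OF A])
  have "prob (A \<inter> {\<omega>\<in>space M. z < \<bar>X (Suc n) \<omega>\<bar>})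
    = (\<integral>\<omega>. indicator (A \<inter> {\<omega>\<in>space M. z < \<bar>X (Suc n) \<omega>\<bar>}) \<omega> \<partial>M)"
    by (subst Bochner_Integration.integral_indicator) (auto intro!: arg_cong[where f = prob])
  also have "\<dots> = (\<integral>\<omega>. indicator A \<omega> * indicator {y. z < \<bar>y\<bar>} (X (Suc n) \<omega>) \<partial>M)"
    by (intro Bochner_Integration.integral_cong) (auto simp: indicator_def)
  also have "\<dots> \<le> jump_tail z * prob A"
  proof (rule transition_bound[where b = 1, OF _ _ _ A])
    fix i assume i: "i < d"
    have "(\<Sum>j<d. \<integral>y. indicator {y. z < \<bar>y\<bar>} y \<partial>\<mu> i j) = (\<Sum>j<d. measure (\<mu> i j) {y. z < \<bar>y\<bar>})"
      using i by (intro sum.cong) (auto simp: kernel_space)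
    also have "\<dots> \<le> jump_tail z" unfolding jump_tail_def using i by (intro row_sum_le) auto
    finally show "(\<Sum>j<d. \<integral>y. indicator {y. z < \<bar>y\<bar>} y \<partial>\<mu> i j) \<le> jump_tail z" .
  qed (auto simp: indicator_def)
  finally show ?thesis .
qed

lemma jumps_bound:
  assumes A: "A \<in> sets (F m)"
  shows "prob (A \<inter> {\<omega>\<in>space M. \<exists>l\<in>{m..<n}. z < \<bar>X (Suc l) \<omega>\<bar>}) \<le> real (n - m) * jump_tail z * prob A"
proof -
  have [measurable]: "A \<in> sets M" by (rule sets_F_M[OF A])
  have "A \<inter> {\<omega>\<in>space M. \<exists>l\<in>{m..<n}. z < \<bar>X (Suc l) \<omega>\<bar>}
    = (\<Union>l\<in>{m..<n}. A \<inter> {\<omega>\<in>space M. z < \<bar>X (Suc l) \<omega>\<bar>})" by auto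
  then have "prob (A \<inter> {\<omega>\<in>space M. \<exists>l\<in>{m..<n}. z < \<bar>X (Suc l) \<omega>\<bar>})
    \<le> (\<Sum>l\<in>{m..<n}. prob (A \<inter> {\<omega>\<in>space M. z < \<bar>X (Suc l) \<omega>\<bar>}))"
    by (simp only:) (rule finite_measure_subadditive_finite, auto)
  also have "\<dots> \<le> (\<Sum>l\<in>{m..<n}. jump_tail z * prob A)"
    using F_mono A by (intro sum_mono jump_bound) auto
  finally show ?thesis by simp
qed

end

section \<open>Maximal inequalities with drift\<close>

context markov_additive
begin

text \<open>Centre the truncated jump plus the increment of \<open>f\<close> by its conditional
  mean, which is at most \<open>c\<close>. The increments of \<open>f\<close> telescope and cost at
  most \<open>2 * f_sum\<close>, hence at most \<open>z / 2\<close>, so a climb by \<open>z\<close>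
  forces the martingale up by \<open>z / 2\<close>.\<close>

lemma truncated_drift_maximal:
  fixes f :: "nat \<Rightarrow> real"
  defines "f_sum \<equiv> \<Sum>i<d. \<bar>f i\<bar>"
    and "y_sum \<equiv> \<Sum>i<d. \<Sum>j<d. \<integral>y. \<bar>y\<bar> \<partial>\<mu> i j"
  assumes drift: "\<And>i. i < d \<Longrightarrow> (\<Sum>j<d. \<integral>y. trunc z y \<partial>\<mu> i j)
      + (\<Sum>j<d. measure (\<mu> i j) UNIV * f j) - f i \<le> c"
    and z: "4 * f_sum \<le> z" "0 < z" and A: "A \<in> sets (F m)" and mn: "m \<le> n"
  shows "prob (A \<inter> {\<omega>\<in>space M. \<exists>k\<in>{m..n}. z < (\<Sum>l=m..<k. trunc z (X (Suc l) \<omega>) - c)})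
    \<le> real (n - m) * (2 * (\<Sum>i<d. \<Sum>j<d. \<integral>y. (trunc z y)\<^sup>2 \<partial>\<mu> i j) + 2 * (4 * f_sum + y_sum)\<^sup>2) * prob A / (z / 2)\<^sup>2"
proof -
  have [measurable]: "A \<in> sets M" by (rule sets_F_M[OF A])
  have f_le: "\<bar>f i\<bar> \<le> f_sum" if "i < d" for i
    unfolding f_sum_def using that by (intro member_le_sum) auto
  have f_sum_nonneg: "f_sum \<ge> 0" unfolding f_sum_def by (intro sum_nonneg) auto
  have tr_int: "integrable (\<mu> i j) (trunc z)" if "i < d" "j < d" for i j
    using that abs_trunc_le(2) by (intro kernel_integrable_bounded[where b = "\<bar>z\<bar>"]) auto
  have tr2_int: "integrable (\<mu> i j) (\<lambda>y. (trunc z y)\<^sup>2)" if "i < d" "j < d" for i j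
    using that power_mono[OF abs_trunc_le(2)[of z] abs_ge_zero, of _ 2]
    by (intro kernel_integrable_bounded[where b = "z\<^sup>2"]) auto
  have const_int: "integrable (\<mu> i j) (\<lambda>y. C)" if "i < d" "j < d" for i j and C :: real
    using that by (intro kernel_integrable_bounded[where b = "\<bar>C\<bar>"]) auto
  define \<Psi> where "\<Psi> i = (\<Sum>j<d. \<integral>y. trunc z y \<partial>\<mu> i j) + (\<Sum>j<d. measure (\<mu> i j) UNIV * f j) - f i" for i
  define \<psi> where "\<psi> i y j = trunc z y + f j - f i - \<Psi> i" for i y j
  have \<psi>_meas: "(\<lambda>y. \<psi> i y j) \<in> borel_measurable borel" for i j
    unfolding \<psi>_def by measurable
  have Pf: "\<bar>\<Sum>j<d. measure (\<mu> i j) UNIV * f j\<bar> \<le> f_sum" if i: "i < d" for i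
  proof -
    have "\<bar>\<Sum>j<d. measure (\<mu> i j) UNIV * f j\<bar> \<le> (\<Sum>j<d. measure (\<mu> i j) UNIV * f_sum)"
      using f_le by (intro order_trans[OF sum_abs] sum_mono) (auto simp: abs_mult intro!: mult_left_mono)
    then show ?thesis using kernel_mass[OF i] by (simp add: sum_distrib_right[symmetric])
  qed
  have trm: "\<bar>\<Sum>j<d. \<integral>y. trunc z y \<partial>\<mu> i j\<bar> \<le> y_sum" if i: "i < d" for i
  proof -
    have "\<bar>\<Sum>j<d. \<integral>y. trunc z y \<partial>\<mu> i j\<bar> \<le> (\<Sum>j<d. \<integral>y. \<bar>y\<bar> \<partial>\<mu> i j)"
    proof (intro order_trans[OF sum_abs] sum_mono)
      fix j assume "j \<in> {..<d}"
      then have j: "j < d" by simp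
      have "\<bar>\<integral>y. trunc z y \<partial>\<mu> i j\<bar> \<le> (\<integral>y. \<bar>trunc z y\<bar> \<partial>\<mu> i j)" by (rule integral_abs_bound)
      also have "\<dots> \<le> (\<integral>y. \<bar>y\<bar> \<partial>\<mu> i j)"
        using tr_int[OF i j] kernel_moment[OF i j] abs_trunc_le(1)
        by (intro integral_mono integrable_abs) auto
      finally show "\<bar>\<integral>y. trunc z y \<partial>\<mu> i j\<bar> \<le> (\<integral>y. \<bar>y\<bar> \<partial>\<mu> i j)" .
    qed
    also have "\<dots> \<le> y_sum" unfolding y_sum_def using i by (intro row_sum_le) auto
    finally show ?thesis .
  qed
  have \<Psi>_bd: "\<bar>\<Psi> i\<bar> \<le> y_sum + 2 * f_sum" if i: "i < d" for i
    unfolding \<Psi>_def using Pf[OF i] trm[OF i] f_le[OF i] by linarith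
  \<comment> \<open>Two of the four \<open>f_sum\<close> come from \<open>f j - f i\<close>; the
    other two, and \<open>y_sum\<close>, come from the centring \<open>\<Psi> i\<close>.\<close>
  have \<psi>_split: "\<bar>\<psi> i y j - trunc z y\<bar> \<le> 4 * f_sum + y_sum" if "i < d" "j < d" for i y j
    unfolding \<psi>_def using \<Psi>_bd[OF that(1)] f_le[OF that(1)] f_le[OF that(2)] by linarith
  have \<psi>_bd: "\<bar>\<psi> i y j\<bar> \<le> \<bar>z\<bar> + (4 * f_sum + y_sum)" if "i < d" "j < d" for i y j
    using \<psi>_split[OF that, of y] abs_trunc_le(2)[of z y] by linarith
  have \<psi>_mean: "(\<Sum>j<d. \<integral>y. \<psi> i y j \<partial>\<mu> i j) = 0" if i: "i < d" for i
  proof -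
    have "(\<Sum>j<d. \<integral>y. \<psi> i y j \<partial>\<mu> i j)
      = (\<Sum>j<d. (\<integral>y. trunc z y \<partial>\<mu> i j) + measure (\<mu> i j) UNIV * f j
          - measure (\<mu> i j) UNIV * (f i + \<Psi> i))"
    proof (rule sum.cong[OF refl])
      fix j assume "j \<in> {..<d}"
      then have j: "j < d" by simp
      have "(\<integral>y. \<psi> i y j \<partial>\<mu> i j) = (\<integral>y. trunc z y + (f j - (f i + \<Psi> i)) \<partial>\<mu> i j)"
        by (simp add: \<psi>_def algebra_simps)
      also have "\<dots> = (\<integral>y. trunc z y \<partial>\<mu> i j) + measure (\<mu> i j) UNIV * (f j - (f i + \<Psi> i))"
        using tr_int[OF i j] const_int[OF i j] by (simp add: kernel_space[OF i j])
      finally show "(\<integral>y. \<psi> i y j \<partial>\<mu> i j) = (\<integral>y. trunc z y \<partial>\<mu> i j) + measure (\<mu> i j) UNIV * f j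
          - measure (\<mu> i j) UNIV * (f i + \<Psi> i)" by (simp add: algebra_simps)
    qed
    also have "\<dots> = \<Psi> i + f i - (\<Sum>j<d. measure (\<mu> i j) UNIV) * (f i + \<Psi> i)"
      unfolding \<Psi>_def by (simp add: sum.distrib sum_subtractf sum_distrib_right)
    finally show ?thesis using kernel_mass[OF i] by simp
  qed
  define D where "D k \<omega> = \<psi> (J k \<omega>) (X (Suc k) \<omega>) (J (Suc k) \<omega>)" for k \<omega>
  define v where "v = 2 * (\<Sum>i<d. \<Sum>j<d. \<integral>y. (trunc z y)\<^sup>2 \<partial>\<mu> i j) + 2 * (4 * f_sum + y_sum)\<^sup>2"
  have v_nonneg: "v \<ge> 0"
    unfolding v_def by (intro add_nonneg_nonneg mult_nonneg_nonneg sum_nonneg) auto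
  have max: "prob (A \<inter> {\<omega>\<in>space M. \<exists>k\<in>{m..n}. z / 2 \<le> (\<Sum>l=m..<k. D l \<omega>)})
    \<le> real (n - m) * v * prob A / (z / 2)\<^sup>2"
  proof (rule martingale_maximal_inequality[OF _ _ _ _ v_nonneg A _ mn])
    show D_meas: "D k \<in> borel_measurable (F (Suc k))" for k
    proof -
      have [measurable]: "J k \<in> measurable (F (Suc k)) (count_space UNIV)"
        by (rule measurable_F_mono[OF _ J_adapted]) simp
      note [measurable] = X_adapted J_adapted
      show ?thesis unfolding D_def \<psi>_def by measurable
    qed
    show "\<bar>D k \<omega>\<bar> \<le> \<bar>z\<bar> + (4 * f_sum + y_sum)" if "\<omega> \<in> space M" for k \<omega>
      unfolding D_def using J_less[OF that] by (intro \<psi>_bd)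
    show "(\<integral>\<omega>. G \<omega> * D k \<omega> \<partial>M) = 0"
      if G: "G \<in> borel_measurable (F k)" "\<And>\<omega>. \<omega> \<in> space M \<Longrightarrow> \<bar>G \<omega>\<bar> \<le> b" for G k b
    proof -
      have "(\<integral>\<omega>. G \<omega> * D k \<omega> \<partial>M) = (\<integral>\<omega>. G \<omega> * (\<Sum>j<d. \<integral>y. \<psi> (J k \<omega>) y j \<partial>\<mu> (J k \<omega>) j) \<partial>M)"
        unfolding D_def by (rule transition_expectation[OF \<psi>_meas \<psi>_bd G])
      also have "\<dots> = (\<integral>\<omega>. 0 \<partial>M)"
        using \<psi>_mean[OF J_less] by (intro Bochner_Integration.integral_cong) auto
      finally show ?thesis by simp
    qed
    show "(\<integral>\<omega>. indicator B \<omega> * (D k \<omega>)\<^sup>2 \<partial>M) \<le> v * prob B" if B: "B \<in> sets (F k)" for k B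
    proof -
      have [measurable]: "B \<in> sets M" by (rule sets_F_M[OF B])
      have [measurable]: "D k \<in> borel_measurable M" by (rule measurable_F_M[OF D_meas])
      define \<phi> where "\<phi> y = 2 * (trunc z y)\<^sup>2 + 2 * (4 * f_sum + y_sum)\<^sup>2" for y
      have [measurable]: "\<phi> \<in> borel_measurable borel" unfolding \<phi>_def by measurable
      have \<phi>_bd: "0 \<le> \<phi> y" "\<phi> y \<le> 2 * z\<^sup>2 + 2 * (4 * f_sum + y_sum)\<^sup>2" for y
        unfolding \<phi>_def using power_mono[OF abs_trunc_le(2)[of z y] abs_ge_zero, of 2] by auto
      have D2: "(D k \<omega>)\<^sup>2 \<le> \<phi> (X (Suc k) \<omega>)" if "\<omega> \<in> space M" for \<omega>
      proof -
        define t where "t = trunc z (X (Suc k) \<omega>)"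
        have "\<bar>D k \<omega> - t\<bar> \<le> 4 * f_sum + y_sum"
          unfolding D_def t_def using J_less[OF that] by (intro \<psi>_split)
        then have "(D k \<omega> - t)\<^sup>2 \<le> (4 * f_sum + y_sum)\<^sup>2"
          using power_mono[OF _ abs_ge_zero, of "D k \<omega> - t" "4 * f_sum + y_sum" 2] by simp
        \<comment> \<open>The difference of the two sides is the square of
          \<open>2 * t - D k \<omega>\<close>.\<close>
        moreover have "(D k \<omega>)\<^sup>2 \<le> 2 * t\<^sup>2 + 2 * (D k \<omega> - t)\<^sup>2"
          using zero_le_power2[of "2 * t - D k \<omega>"] by (simp add: power2_eq_square algebra_simps)
        ultimately show ?thesis unfolding \<phi>_def t_def by linarith
      qed
      have bds: "integrable M (\<lambda>\<omega>. indicator B \<omega> * \<phi> (X (Suc k) \<omega>))"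
        using \<phi>_bd order_trans[OF \<phi>_bd]
        by (intro integrable_const_bound[of _ "2 * z\<^sup>2 + 2 * (4 * f_sum + y_sum)\<^sup>2"]) (auto simp: indicator_def)
      have "(\<integral>\<omega>. indicator B \<omega> * (D k \<omega>)\<^sup>2 \<partial>M) \<le> (\<integral>\<omega>. indicator B \<omega> * \<phi> (X (Suc k) \<omega>) \<partial>M)"
      proof (rule integral_mono[OF _ bds])
        show "integrable M (\<lambda>\<omega>. indicator B \<omega> * (D k \<omega>)\<^sup>2)"
        proof (rule Bochner_Integration.integrable_bound[OF bds])
          show "AE \<omega> in M. norm (indicator B \<omega> * (D k \<omega>)\<^sup>2) \<le> norm (indicator B \<omega> * \<phi> (X (Suc k) \<omega>))"
            using D2 \<phi>_bd by (intro AE_I2) (auto simp: indicator_def)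
        qed measurable
        show "indicator B \<omega> * (D k \<omega>)\<^sup>2 \<le> indicator B \<omega> * \<phi> (X (Suc k) \<omega>)" if "\<omega> \<in> space M" for \<omega>
          using D2[OF that] by (intro mult_left_mono) auto
      qed
      also have "\<dots> \<le> v * prob B"
      proof (rule transition_bound[OF _ \<phi>_bd B])
        fix i assume i: "i < d"
        have "(\<Sum>j<d. \<integral>y. \<phi> y \<partial>\<mu> i j)
          = (\<Sum>j<d. 2 * (\<integral>y. (trunc z y)\<^sup>2 \<partial>\<mu> i j) + 2 * (4 * f_sum + y_sum)\<^sup>2 * measure (\<mu> i j) UNIV)"
        proof (rule sum.cong[OF refl])
          fix j assume "j \<in> {..<d}"
          then have j: "j < d" by simp
          have "(\<integral>y. \<phi> y \<partial>\<mu> i j)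
            = (\<integral>y. 2 * (trunc z y)\<^sup>2 \<partial>\<mu> i j) + (\<integral>y. 2 * (4 * f_sum + y_sum)\<^sup>2 \<partial>\<mu> i j)"
            unfolding \<phi>_def using tr2_int[OF i j] const_int[OF i j]
            by (intro Bochner_Integration.integral_add) auto
          then show "(\<integral>y. \<phi> y \<partial>\<mu> i j)
            = 2 * (\<integral>y. (trunc z y)\<^sup>2 \<partial>\<mu> i j) + 2 * (4 * f_sum + y_sum)\<^sup>2 * measure (\<mu> i j) UNIV"
            by (simp add: kernel_space[OF i j])
        qed
        also have "\<dots> = 2 * (\<Sum>j<d. \<integral>y. (trunc z y)\<^sup>2 \<partial>\<mu> i j) + 2 * (4 * f_sum + y_sum)\<^sup>2"
          using kernel_mass[OF i] by (simp only: sum.distrib sum_distrib_left[symmetric] mult_1_right)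
        also have "\<dots> \<le> v"
          unfolding v_def using i by (intro add_mono mult_left_mono row_sum_le) auto
        finally show "(\<Sum>j<d. \<integral>y. \<phi> y \<partial>\<mu> i j) \<le> v" .
      qed simp
      finally show ?thesis .
    qed
  qed (use z in auto)
  have [measurable]: "D k \<in> borel_measurable M" for k
    unfolding D_def \<psi>_def by measurable
  have "prob (A \<inter> {\<omega>\<in>space M. \<exists>k\<in>{m..n}. z < (\<Sum>l=m..<k. trunc z (X (Suc l) \<omega>) - c)})
    \<le> prob (A \<inter> {\<omega>\<in>space M. \<exists>k\<in>{m..n}. z / 2 \<le> (\<Sum>l=m..<k. D l \<omega>)})"
  proof (rule finite_measure_mono)
    have "z / 2 \<le> (\<Sum>l=m..<k. D l \<omega>)"
      if \<omega>: "\<omega> \<in> space M" and k: "m \<le> k" and gt: "z < (\<Sum>l=m..<k. trunc z (X (Suc l) \<omega>) - c)" for k \<omega>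
    proof -
      have "(\<Sum>l=m..<k. trunc z (X (Suc l) \<omega>) - c) + (\<Sum>l=m..<k. f (J (Suc l) \<omega>) - f (J l \<omega>)) \<le> (\<Sum>l=m..<k. D l \<omega>)"
        unfolding sum.distrib[symmetric]
      proof (rule sum_mono)
        fix l
        show "trunc z (X (Suc l) \<omega>) - c + (f (J (Suc l) \<omega>) - f (J l \<omega>)) \<le> D l \<omega>"
          using drift[OF J_less[OF \<omega>, of l]] by (simp add: D_def \<psi>_def \<Psi>_def)
      qed
      moreover have "(\<Sum>l=m..<k. f (J (Suc l) \<omega>) - f (J l \<omega>)) = f (J k \<omega>) - f (J m \<omega>)"
        using k by (rule sum_Suc_diff'[of m k "\<lambda>l. f (J l \<omega>)"])
      ultimately show ?thesis
        using gt f_le[OF J_less[OF \<omega>, of k]] f_le[OF J_less[OF \<omega>, of m]] z by (simp add: abs_le_iff)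
    qed
    then show "A \<inter> {\<omega>\<in>space M. \<exists>k\<in>{m..n}. z < (\<Sum>l=m..<k. trunc z (X (Suc l) \<omega>) - c)}
      \<subseteq> A \<inter> {\<omega>\<in>space M. \<exists>k\<in>{m..n}. z / 2 \<le> (\<Sum>l=m..<k. D l \<omega>)}"
      by (intro Int_mono order_refl Collect_mono) (meson atLeastAtMost_iff)
  qed measurable
  also note max
  finally show ?thesis unfolding v_def .
qed

text \<open>One rate \<open>g\<close> serves all starting times, horizons and past events. The
  excess \<open>\<eta>\<close> is there because truncated means only converge: for large
  \<open>z\<close> the truncated drift is below \<open>h + \<eta>\<close> in each of the finitely
  many states.\<close>

lemma drift_maximal:
  fixes f :: "nat \<Rightarrow> real"
  assumes drift: "\<And>i. i < d \<Longrightarrow> (\<Sum>j<d. \<integral>y. y \<partial>\<mu> i j)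
      + (\<Sum>j<d. measure (\<mu> i j) UNIV * f j) - f i = h"
    and \<eta>: "\<eta> > 0"
  shows "\<exists>g. (g \<longlongrightarrow> 0) at_top \<and> (\<forall>\<^sub>F z in at_top. \<forall>m n A. A \<in> sets (F m) \<longrightarrow> m \<le> n \<longrightarrow>
      prob (A \<inter> {\<omega>\<in>space M. \<exists>k\<in>{m..n}. z < (\<Sum>l=m..<k. X (Suc l) \<omega> - (h + \<eta>))})
      \<le> real (n - m) * g z / z * prob A)"
proof -
  define f_sum where "f_sum = (\<Sum>i<d. \<bar>f i\<bar>)"
  define y_sum where "y_sum = (\<Sum>i<d. \<Sum>j<d. \<integral>y. \<bar>y\<bar> \<partial>\<mu> i j)"
  define V where "V z = (\<Sum>i<d. \<Sum>j<d. \<integral>y. (trunc z y)\<^sup>2 \<partial>\<mu> i j)" for z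
  define C where "C = 2 * (4 * f_sum + y_sum)\<^sup>2"
  \<comment> \<open>The first term comes from the union bound over jumps larger than
    \<open>z\<close>, the second from the martingale bound at height \<open>z / 2\<close>; both are
    written so that the factor \<open>real (n - m) / z\<close> stands in front.\<close>
  define g where "g z = z * jump_tail z + 4 * ((2 * V z + C) / z)" for z
  have moments: "((\<lambda>z. \<integral>y. trunc z y \<partial>\<mu> i j) \<longlongrightarrow> (\<integral>y. y \<partial>\<mu> i j)) at_top"
    "((\<lambda>z. (\<integral>y. (trunc z y)\<^sup>2 \<partial>\<mu> i j) / z) \<longlongrightarrow> 0) at_top"
    "((\<lambda>z. z * measure (\<mu> i j) {y. z < \<bar>y\<bar>}) \<longlongrightarrow> 0) at_top" if "i < d" "j < d" for i j
    using trunc_moments[OF kernel_finite kernel_sets kernel_moment, of i j] that by auto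
  have tail0: "((\<lambda>z. z * jump_tail z) \<longlongrightarrow> 0) at_top"
    unfolding jump_tail_def sum_distrib_left using moments(3) by (intro tendsto_null_sum) auto
  have V0: "((\<lambda>z. V z / z) \<longlongrightarrow> 0) at_top"
    unfolding V_def sum_divide_distrib using moments(2) by (intro tendsto_null_sum) auto
  have C0: "((\<lambda>z. C / z) \<longlongrightarrow> 0) at_top"
    by (rule tendsto_divide_0[OF tendsto_const filterlim_at_top_imp_at_infinity[OF filterlim_ident]])
  have "((\<lambda>z. z * jump_tail z + 4 * (2 * (V z / z) + C / z)) \<longlongrightarrow> 0 + 4 * (2 * 0 + 0)) at_top"
    by (intro tendsto_intros tail0 V0 C0)
  then have g0: "(g \<longlongrightarrow> 0) at_top" by (simp add: g_def[abs_def] add_divide_distrib)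
  have "\<forall>\<^sub>F z in at_top. \<forall>i\<in>{..<d}. (\<Sum>j<d. \<integral>y. trunc z y \<partial>\<mu> i j) < (\<Sum>j<d. \<integral>y. y \<partial>\<mu> i j) + \<eta>"
  proof (rule eventually_ball_finite[OF finite_lessThan], intro ballI)
    fix i assume "i \<in> {..<d}"
    then have "((\<lambda>z. \<Sum>j<d. \<integral>y. trunc z y \<partial>\<mu> i j) \<longlongrightarrow> (\<Sum>j<d. \<integral>y. y \<partial>\<mu> i j)) at_top"
      using moments(1) by (intro tendsto_sum) auto
    then show "\<forall>\<^sub>F z in at_top. (\<Sum>j<d. \<integral>y. trunc z y \<partial>\<mu> i j) < (\<Sum>j<d. \<integral>y. y \<partial>\<mu> i j) + \<eta>"
      using \<eta> by (intro order_tendstoD(2)) auto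
  qed
  moreover have "\<forall>\<^sub>F z in at_top. 4 * f_sum \<le> z" "\<forall>\<^sub>F z in at_top. 0 < (z::real)"
    by (rule eventually_ge_at_top, rule eventually_gt_at_top)
  ultimately have "\<forall>\<^sub>F z in at_top. \<forall>m n A. A \<in> sets (F m) \<longrightarrow> m \<le> n \<longrightarrow>
      prob (A \<inter> {\<omega>\<in>space M. \<exists>k\<in>{m..n}. z < (\<Sum>l=m..<k. X (Suc l) \<omega> - (h + \<eta>))})
      \<le> real (n - m) * g z / z * prob A"
  proof (eventually_elim, intro allI impI)
    fix z m n A
    assume mean: "\<forall>i\<in>{..<d}. (\<Sum>j<d. \<integral>y. trunc z y \<partial>\<mu> i j) < (\<Sum>j<d. \<integral>y. y \<partial>\<mu> i j) + \<eta>"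
      and z: "4 * f_sum \<le> z" "0 < z" and A: "A \<in> sets (F m)" and mn: "m \<le> (n::nat)"
    have [measurable]: "A \<in> sets M" by (rule sets_F_M[OF A])
    have le: "(\<Sum>j<d. \<integral>y. trunc z y \<partial>\<mu> i j) + (\<Sum>j<d. measure (\<mu> i j) UNIV * f j) - f i \<le> h + \<eta>"
      if "i < d" for i
      using mean drift[OF that] that by (auto dest!: bspec[of _ _ i])
    define E1 where "E1 = A \<inter> {\<omega>\<in>space M. \<exists>l\<in>{m..<n}. z < \<bar>X (Suc l) \<omega>\<bar>}"
    define E2 where "E2 = A \<inter> {\<omega>\<in>space M. \<exists>k\<in>{m..n}. z < (\<Sum>l=m..<k. trunc z (X (Suc l) \<omega>) - (h + \<eta>))}"
    have [measurable]: "E1 \<in> sets M" "E2 \<in> sets M" unfolding E1_def E2_def by measurable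
    have "prob (A \<inter> {\<omega>\<in>space M. \<exists>k\<in>{m..n}. z < (\<Sum>l=m..<k. X (Suc l) \<omega> - (h + \<eta>))}) \<le> prob (E1 \<union> E2)"
    proof (rule finite_measure_mono)
      show "A \<inter> {\<omega>\<in>space M. \<exists>k\<in>{m..n}. z < (\<Sum>l=m..<k. X (Suc l) \<omega> - (h + \<eta>))} \<subseteq> E1 \<union> E2"
      proof
        fix \<omega> assume "\<omega> \<in> A \<inter> {\<omega>\<in>space M. \<exists>k\<in>{m..n}. z < (\<Sum>l=m..<k. X (Suc l) \<omega> - (h + \<eta>))}"
        then obtain k where k: "\<omega> \<in> A" "\<omega> \<in> space M" "k \<in> {m..n}"
          "z < (\<Sum>l=m..<k. X (Suc l) \<omega> - (h + \<eta>))" by auto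
        show "\<omega> \<in> E1 \<union> E2"
        proof (cases "\<omega> \<in> E1")
          case False
          have "trunc z (X (Suc l) \<omega>) = X (Suc l) \<omega>" if "l \<in> {m..<k}" for l
          proof -
            have "l \<in> {m..<n}" using that k(3) by auto
            then have "\<bar>X (Suc l) \<omega>\<bar> \<le> z" using False k(1,2) by (auto simp: E1_def not_less)
            then show ?thesis by (simp add: trunc_def)
          qed
          then have "(\<Sum>l=m..<k. trunc z (X (Suc l) \<omega>) - (h + \<eta>)) = (\<Sum>l=m..<k. X (Suc l) \<omega> - (h + \<eta>))"
            by (intro sum.cong) auto
          with k(4) have "z < (\<Sum>l=m..<k. trunc z (X (Suc l) \<omega>) - (h + \<eta>))"
            by simp
          then show ?thesis using k unfolding E2_def by auto
        qed simp
      qed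
    qed measurable
    also have "\<dots> \<le> prob E1 + prob E2" by (rule measure_Un_le) measurable
    also have "\<dots> \<le> real (n - m) * jump_tail z * prob A + real (n - m) * (2 * V z + C) * prob A / (z / 2)\<^sup>2"
      unfolding E1_def E2_def V_def C_def f_sum_def y_sum_def
      by (intro add_mono jumps_bound[OF A] truncated_drift_maximal[OF le _ z(2) A mn])
        (use z in \<open>auto simp: f_sum_def\<close>)
    also have "\<dots> = real (n - m) * g z / z * prob A"
      using z(2) by (simp add: g_def field_simps power2_eq_square)
    finally show "prob (A \<inter> {\<omega>\<in>space M. \<exists>k\<in>{m..n}. z < (\<Sum>l=m..<k. X (Suc l) \<omega> - (h + \<eta>))})
      \<le> real (n - m) * g z / z * prob A" .
  qed
  with g0 show ?thesis by (intro exI conjI)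
qed

text \<open>
  Each further climb by \<open>z\<close> starts at a first passage time and overshoots by at most \<open>y\<close>, so its
  conditional probability is again at most \<open>q\<close>.
\<close>

lemma iterated_climb:
  assumes q: "q \<ge> 0" and c: "c \<ge> 0"
    and climb: "\<And>m A. A \<in> sets (F m) \<Longrightarrow> m \<le> n \<Longrightarrow>
      prob (A \<inter> {\<omega>\<in>space M. \<exists>k\<in>{m..n}. z < (\<Sum>l=m..<k. X (Suc l) \<omega> - c)}) \<le> q * prob A"
    and A: "A \<in> sets (F m)" and mn: "m \<le> n" and y: "z + y \<ge> 0" and z: "z \<ge> 0"
  shows "prob (A \<inter> {\<omega>\<in>space M. (\<forall>l\<in>{m..<n}. X (Suc l) \<omega> \<le> y) \<and>
      (\<exists>k\<in>{m..n}. real r * (z + y) < (\<Sum>l=m..<k. X (Suc l) \<omega> - c))}) \<le> q ^ r * prob A"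
  using A mn
proof (induction r arbitrary: m A)
  case 0
  then have "A \<in> sets M" by (intro sets_F_M)
  then show ?case by (auto intro!: finite_measure_mono)
next
  case (Suc r)
  have [measurable]: "A \<in> sets M" by (rule sets_F_M[OF Suc.prems(1)])
  define R where "R m k \<omega> = (\<Sum>l=m..<k. X (Suc l) \<omega> - c)" for m k \<omega>
  have R_F: "R m k \<in> borel_measurable (F k)" for m k
    unfolding R_def by (intro borel_measurable_sum borel_measurable_diff borel_measurable_const
        measurable_F_mono[OF _ X_adapted]) auto
  have [measurable]: "R m k \<in> borel_measurable M" for m k by (rule measurable_F_M[OF R_F])
  \<comment> \<open>First passage above \<open>z\<close> happens exactly at time \<open>k\<close>.
    These events are disjoint and known at time \<open>k\<close>, so the argument can restart from
    each of them.\<close>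
  define B where "B k = A \<inter> {\<omega>\<in>space M. z < R m k \<omega> \<and> (\<forall>l\<in>{m..<k}. R m l \<omega> \<le> z)}" for k
  have B_F: "B k \<in> sets (F k)" if "m \<le> k" for k
  proof -
    have [measurable]: "A \<in> sets (F k)" using Suc.prems(1) F_mono[OF that] by auto
    have "{\<omega>\<in>space (F k). z < R m k \<omega>} \<in> sets (F k)" using R_F[of m k] by measurable
    moreover have "{\<omega>\<in>space (F k). \<forall>l\<in>{m..<k}. R m l \<omega> \<le> z} \<in> sets (F k)"
    proof (rule sets.sets_Collect_finite_All)
      fix l assume "l \<in> {m..<k}"
      then have [measurable]: "R m l \<in> borel_measurable (F k)"
        by (intro measurable_F_mono[OF _ R_F]) simp
      show "{\<omega>\<in>space (F k). R m l \<omega> \<le> z} \<in> sets (F k)" by measurable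
    qed auto
    moreover have "B k = A \<inter> ({\<omega>\<in>space (F k). z < R m k \<omega>} \<inter> {\<omega>\<in>space (F k). \<forall>l\<in>{m..<k}. R m l \<omega> \<le> z})"
      by (auto simp: B_def space_F)
    ultimately show ?thesis by auto
  qed
  define E where "E k = B k \<inter> {\<omega>\<in>space M. (\<forall>l\<in>{k..<n}. X (Suc l) \<omega> \<le> y) \<and>
      (\<exists>k'\<in>{k..n}. real r * (z + y) < R k k' \<omega>)}" for k
  have B_M: "B k \<in> sets M" for k unfolding B_def by measurable
  then have E_M: "E k \<in> sets M" for k unfolding E_def by measurable
  have disj: "disjoint_family_on B {m..n}"
  proof -
    have "B k \<inter> B l = {}" if "m \<le> k" "k < l" for k l
      using that by (auto simp: B_def not_le[symmetric])
    then show ?thesis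
      unfolding disjoint_family_on_def by (metis atLeastAtMost_iff Int_commute linorder_neqE_nat)
  qed
  have "prob (A \<inter> {\<omega>\<in>space M. (\<forall>l\<in>{m..<n}. X (Suc l) \<omega> \<le> y) \<and>
      (\<exists>k\<in>{m..n}. real (Suc r) * (z + y) < R m k \<omega>)}) \<le> prob (\<Union>k\<in>{m..n}. E k)"
  proof (rule finite_measure_mono)
    show "A \<inter> {\<omega>\<in>space M. (\<forall>l\<in>{m..<n}. X (Suc l) \<omega> \<le> y) \<and>
      (\<exists>k\<in>{m..n}. real (Suc r) * (z + y) < R m k \<omega>)} \<subseteq> (\<Union>k\<in>{m..n}. E k)"
    proof
      fix \<omega> assume \<omega>: "\<omega> \<in> A \<inter> {\<omega>\<in>space M. (\<forall>l\<in>{m..<n}. X (Suc l) \<omega> \<le> y) \<and>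
        (\<exists>k\<in>{m..n}. real (Suc r) * (z + y) < R m k \<omega>)}"
      then obtain k' where k': "k' \<in> {m..n}" "real (Suc r) * (z + y) < R m k' \<omega>" by auto
      have jump: "X (Suc l) \<omega> \<le> y" if "l \<in> {m..<n}" for l using \<omega> that by auto
      define k where "k = (LEAST k. k \<ge> m \<and> z < R m k \<omega>)"
      have R0: "R m m \<omega> = 0" by (simp add: R_def)
      show "\<omega> \<in> (\<Union>k\<in>{m..n}. E k)"
      proof (cases "\<exists>k\<in>{m..k'}. z < R m k \<omega>")
        case True
        then have ex: "\<exists>k. k \<ge> m \<and> z < R m k \<omega>" by auto
        have k: "m \<le> k" "z < R m k \<omega>" using LeastI_ex[OF ex] unfolding k_def by auto
        have kk': "k \<le> k'"
        proof -
          from True obtain k1 where "k1 \<in> {m..k'}" "z < R m k1 \<omega>" by auto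
          then have "k \<le> k1" unfolding k_def by (intro Least_le) auto
          then show ?thesis using \<open>k1 \<in> {m..k'}\<close> by auto
        qed
        have first: "R m l \<omega> \<le> z" if "l \<in> {m..<k}" for l
          using not_less_Least[of l "\<lambda>k. k \<ge> m \<and> z < R m k \<omega>"] that unfolding k_def by auto
        \<comment> \<open>Since \<open>z \<ge> 0\<close>, the passage is not at the start, so there
          is a last step before it; as \<open>c \<ge> 0\<close>, that step overshoots by at most
          \<open>y\<close>.\<close>
        have "k \<noteq> m" using k(2) R0 z by auto
        then obtain p where p: "k = Suc p" "m \<le> p" using k(1) by (cases k) auto
        have "R m k \<omega> = R m p \<omega> + (X (Suc p) \<omega> - c)" using p by (simp add: R_def)
        also have "\<dots> \<le> z + y"
          using first[of p] jump[of p] p k'(1) kk' c by auto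
        finally have Rk: "R m k \<omega> \<le> z + y" .
        have "R m k' \<omega> = R m k \<omega> + R k k' \<omega>"
          unfolding R_def using k(1) kk' by (simp add: sum.atLeastLessThan_concat)
        then have "real r * (z + y) < R k k' \<omega>" using Rk k'(2) by (simp add: algebra_simps)
        then have "\<omega> \<in> E k" using \<omega> k kk' k'(1) first by (auto simp: E_def B_def)
        then show ?thesis using k(1) kk' k'(1) by auto
      next
        \<comment> \<open>Without a passage above \<open>z\<close> the level reached is at most
          \<open>z\<close>, so \<open>(r + 1) * (z + y) < z\<close>. This needs
          \<open>y < 0\<close>; but then all jumps are negative and the nonnegative level cannot be
          exceeded.\<close>
        case False
        then have "\<not> z < R m k' \<omega>" using k'(1) by (meson atLeastAtMost_iff order_refl)
        then have "R m k' \<omega> \<le> z" by simp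
        moreover have "real r * (z + y) \<ge> 0" using y by simp
        moreover have "z + y < z"
          using calculation k'(2) by (simp add: algebra_simps)
        ultimately have yneg: "y < 0" by simp
        have "R m l \<omega> \<le> 0" if "l \<le> n" for l
          unfolding R_def using jump yneg c that by (intro sum_nonpos) force
        then have "R m k' \<omega> \<le> 0" using k'(1) by auto
        moreover have "0 \<le> real (Suc r) * (z + y)" using y by (intro mult_nonneg_nonneg) auto
        ultimately show ?thesis using k'(2) by linarith
      qed
    qed
  qed (use E_M in auto)
  also have "\<dots> \<le> (\<Sum>k\<in>{m..n}. prob (E k))"
    using E_M by (intro finite_measure_subadditive_finite) auto
  \<comment> \<open>The induction hypothesis is applied at starting time \<open>k\<close> with past
    event \<open>B k\<close>. Summing over the disjoint \<open>B k\<close> recovers the event of a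
    first climb, which supplies the remaining factor \<open>q\<close>.\<close>
  also have "\<dots> \<le> (\<Sum>k\<in>{m..n}. q ^ r * prob (B k))"
    unfolding E_def R_def using B_F by (intro sum_mono Suc.IH) auto
  also have "\<dots> = q ^ r * prob (\<Union>k\<in>{m..n}. B k)"
    using disj B_M by (subst finite_measure_finite_Union) (auto simp: sum_distrib_left)
  also have "\<dots> \<le> q ^ r * (q * prob A)"
  proof (rule mult_left_mono)
    have "prob (\<Union>k\<in>{m..n}. B k) \<le> prob (A \<inter> {\<omega>\<in>space M. \<exists>k\<in>{m..n}. z < R m k \<omega>})"
      by (rule finite_measure_mono) (auto simp: B_def)
    also have "\<dots> \<le> q * prob A" unfolding R_def using Suc.prems by (intro climb)
    finally show "prob (\<Union>k\<in>{m..n}. B k) \<le> q * prob A" .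
  qed (use q in simp)
  finally show ?case unfolding R_def by (simp add: mult_ac)
qed

end

section \<open>Class C tails\<close>

lemma classC_ratio:
  assumes C: "classC M T" and \<epsilon>: "0 < \<epsilon>"
  obtains v where "v > 1"
    and "\<forall>\<^sub>F x in at_top. (1 - \<epsilon>) * measure M {\<omega>\<in>space M. T \<omega> > x} \<le> measure M {\<omega>\<in>space M. T \<omega> > v * x}"
proof -
  define Q where "Q x = measure M {\<omega>\<in>space M. T \<omega> > x}" for x
  have lim: "((\<lambda>v. Liminf at_top (\<lambda>x. ereal (Q (v * x) / Q x))) \<longlongrightarrow> 1) (at_right 1)"
    and pos: "\<And>x. 0 \<le> x \<Longrightarrow> 0 < Q x" using C unfolding classC_def Q_def by auto
  have "\<forall>\<^sub>F v in at_right 1. ereal (1 - \<epsilon>) < Liminf at_top (\<lambda>x. ereal (Q (v * x) / Q x))"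
    using \<epsilon> by (intro order_tendstoD(1)[OF lim]) auto
  moreover have "\<forall>\<^sub>F v in at_right (1::real). 1 < v" by (rule eventually_at_right_less)
  ultimately have "\<forall>\<^sub>F v in at_right (1::real). 1 < v \<and>
      ereal (1 - \<epsilon>) < Liminf at_top (\<lambda>x. ereal (Q (v * x) / Q x))"
    by eventually_elim simp
  then obtain v where v: "1 < v" "ereal (1 - \<epsilon>) < Liminf at_top (\<lambda>x. ereal (Q (v * x) / Q x))"
    using eventually_happens'[OF trivial_limit_at_right_real] by blast
  have "\<forall>\<^sub>F x in at_top. ereal (1 - \<epsilon>) < ereal (Q (v * x) / Q x)"
    by (rule less_LiminfD[OF v(2)])
  then have "\<forall>\<^sub>F x in at_top. (1 - \<epsilon>) * Q x \<le> Q (v * x)"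
    using eventually_ge_at_top[of 0]
  proof eventually_elim
    case (elim x)
    then show ?case using pos[of x] by (simp add: field_simps)
  qed
  then show thesis using v(1) by (intro that) (auto simp: Q_def)
qed

locale classC_tail = prob_space M for M :: "'a measure" +
  fixes T :: "'a \<Rightarrow> real"
  assumes T_M [measurable]: "T \<in> borel_measurable M" and T_C: "classC M T"
begin

definition Q :: "real \<Rightarrow> real" where
  "Q x = prob {\<omega>\<in>space M. T \<omega> > x}"

lemma T_nonneg: "\<omega> \<in> space M \<Longrightarrow> 0 \<le> T \<omega>"
  using T_C unfolding classC_def by blast

lemma Q_pos: "0 \<le> x \<Longrightarrow> 0 < Q x"
  using T_C unfolding classC_def Q_def by blast

lemma Q_antimono: "x \<le> y \<Longrightarrow> Q y \<le> Q x"
  unfolding Q_def by (intro finite_measure_mono) auto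

lemma Q_doubling:
  "\<exists>v>1. \<exists>x0>0. \<forall>x\<ge>x0. Q x \<le> 2 * Q (v * x)"
proof -
  obtain v where v: "v > 1" "\<forall>\<^sub>F x in at_top. (1 - 1/2) * Q x \<le> Q (v * x)"
    using classC_ratio[OF T_C, of "1/2"] unfolding Q_def by auto
  then obtain x0 where "\<And>x. x0 \<le> x \<Longrightarrow> (1 - 1/2) * Q x \<le> Q (v * x)"
    unfolding eventually_at_top_linorder by auto
  then have "\<forall>x\<ge>max x0 1. Q x \<le> 2 * Q (v * x)" by force
  then show ?thesis using v(1)
    by (intro exI[of _ v] conjI exI[of _ "max x0 1"]) simp_all
qed

text \<open>Dominated variation: iterate the doubling inequality until \<open>v ^ m\<close> exceeds
  \<open>1 / \<delta>\<close>. It allows \<open>o(Q)\<close> hypotheses to be used at a fixed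
  fraction of the level.\<close>

lemma Q_scale:
  assumes \<delta>: "\<delta> > 0"
  obtains C where "C > 0" "\<forall>\<^sub>F x in at_top. Q (\<delta> * x) \<le> C * Q x"
proof -
  obtain v x0 where v: "v > 1" "x0 > 0" "\<And>x. x0 \<le> x \<Longrightarrow> Q x \<le> 2 * Q (v * x)"
    using Q_doubling by blast
  obtain m where m: "1 / \<delta> < v ^ m" using real_arch_pow[OF v(1)] by blast
  have iter: "Q x \<le> 2 ^ m * Q (v ^ m * x)" if "x0 \<le> x" for x m
  proof (induction m)
    case (Suc m)
    have "x0 * 1 \<le> x * v ^ m" using that v by (intro mult_mono) auto
    then have "Q (v ^ m * x) \<le> 2 * Q (v * (v ^ m * x))"
      by (intro v(3)) (simp add: mult.commute)
    then have "2 ^ m * Q (v ^ m * x) \<le> 2 ^ m * (2 * Q (v * (v ^ m * x)))"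
      by (intro mult_left_mono) auto
    also have "\<dots> = 2 ^ Suc m * Q (v ^ Suc m * x)" by (simp add: mult_ac)
    finally show ?case using Suc by linarith
  qed simp
  have "\<forall>\<^sub>F x in at_top. Q (\<delta> * x) \<le> 2 ^ m * Q x"
    using eventually_ge_at_top[of "x0 / \<delta>"]
  proof eventually_elim
    case (elim x)
    then have x: "x0 \<le> \<delta> * x" using \<delta> by (simp add: field_simps)
    then have "0 < x" using v(2) \<delta> by (smt (verit) mult_nonneg_nonpos)
    have "1 \<le> v ^ m * \<delta>" using m \<delta> by (simp add: field_simps)
    then have "x \<le> v ^ m * (\<delta> * x)" using \<open>0 < x\<close> by (simp add: mult.assoc[symmetric])
    then have "Q (v ^ m * (\<delta> * x)) \<le> Q x" by (rule Q_antimono)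
    then show ?case using iter[OF x, of m] by (smt (verit) mult_left_mono zero_le_power)
  qed
  then show thesis by (intro that[of "2 ^ m"]) auto
qed

lemma truncated_power_integrable:
  "integrable M (\<lambda>\<omega>. indicator {\<omega>\<in>space M. T \<omega> \<le> x} \<omega> * (T \<omega> / x) ^ K)"
proof (rule integrable_const_bound[of _ 1])
  show "AE \<omega> in M. norm (indicator {\<omega>\<in>space M. T \<omega> \<le> x} \<omega> * (T \<omega> / x) ^ K) \<le> 1"
  proof (rule AE_I2)
    fix \<omega> assume \<omega>: "\<omega> \<in> space M"
    \<comment> \<open>This includes \<open>x \<le> 0\<close>: for \<open>x = 0\<close> the quotient
      is 0 by convention, and for \<open>x < 0\<close> the premise contradicts
      \<open>T \<omega> \<ge> 0\<close>.\<close>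
    have "\<bar>T \<omega> / x\<bar> \<le> 1" if "T \<omega> \<le> x" using that T_nonneg[OF \<omega>] by (auto simp: divide_le_eq_1 zero_le_divide_iff)
    then show "norm (indicator {\<omega>\<in>space M. T \<omega> \<le> x} \<omega> * (T \<omega> / x) ^ K) \<le> 1"
      by (auto simp: indicator_def power_le_one_iff power_abs intro!: power_le_one)
  qed
qed measurable

text \<open>Compare the levels \<open>u\<close> and \<open>v * u\<close>. On
  \<open>T \<le> u\<close> the integrand shrinks by the factor \<open>v ^ K\<close>, and between the
  two levels it is at most 1, which adds no more than \<open>Q u\<close>. Choosing \<open>K\<close>
  large makes this recursion contract faster than \<open>Q\<close> decays.\<close>

lemma truncated_power_moment:
  obtains K C where "K \<ge> 1" "C > 0"
    "\<forall>\<^sub>F x in at_top. (\<integral>\<omega>. indicator {\<omega>\<in>space M. T \<omega> \<le> x} \<omega> * (T \<omega> / x) ^ K \<partial>M) \<le> C * Q x"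
proof -
  obtain v x0 where v: "v > 1" "x0 > 0" and dbl: "\<And>x. x0 \<le> x \<Longrightarrow> Q x \<le> 2 * Q (v * x)"
    using Q_doubling by blast
  obtain K where K: "4 < v ^ K" using real_arch_pow[OF v(1)] by blast
  then have K1: "K \<ge> 1" by (cases K) auto
  define a where "a x = (\<integral>\<omega>. indicator {\<omega>\<in>space M. T \<omega> \<le> x} \<omega> * (T \<omega> / x) ^ K \<partial>M)" for x
  \<comment> \<open>The entry 4 gives \<open>C / 2 + 2 \<le> C\<close> in the induction. The other
    entry settles the first interval from \<open>x0\<close> to \<open>v * x0\<close>, where the
    integral is at most 1 and \<open>Q\<close> at least \<open>Q (v * x0)\<close>.\<close>
  define C where "C = max 4 (1 / Q (v * x0))"
  have C4: "C \<ge> 4" by (simp add: C_def)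
  have step: "a (v * u) \<le> a u / 4 + Q u" if u: "u > 0" for u
  proof -
    have "a (v * u) \<le> (\<integral>\<omega>. (indicator {\<omega>\<in>space M. T \<omega> \<le> u} \<omega> * (T \<omega> / u) ^ K) / 4
      + indicator {\<omega>\<in>space M. T \<omega> > u} \<omega> \<partial>M)"
      unfolding a_def
    proof (rule integral_mono[OF truncated_power_integrable])
      show "integrable M (\<lambda>\<omega>. (indicator {\<omega>\<in>space M. T \<omega> \<le> u} \<omega> * (T \<omega> / u) ^ K) / 4
        + indicator {\<omega>\<in>space M. T \<omega> > u} \<omega>)"
        by (intro Bochner_Integration.integrable_add integrable_divide_zero truncated_power_integrable
            integrable_real_indicator) (auto simp: emeasure_eq_measure)
      fix \<omega> assume \<omega>: "\<omega> \<in> space M"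
      have nn: "0 \<le> T \<omega>" by (rule T_nonneg[OF \<omega>])
      show "indicator {\<omega>\<in>space M. T \<omega> \<le> v * u} \<omega> * (T \<omega> / (v * u)) ^ K
        \<le> (indicator {\<omega>\<in>space M. T \<omega> \<le> u} \<omega> * (T \<omega> / u) ^ K) / 4 + indicator {\<omega>\<in>space M. T \<omega> > u} \<omega>"
      proof (cases "T \<omega> \<le> u")
        case True
        have "u \<le> v * u" using u v by simp
        have "(T \<omega> / (v * u)) ^ K = (T \<omega> / u) ^ K / v ^ K" by (simp add: power_divide power_mult_distrib)
        also have "\<dots> \<le> (T \<omega> / u) ^ K / 4" using K nn u by (intro divide_left_mono) auto
        finally show ?thesis using True \<omega> \<open>u \<le> v * u\<close> by simp
      next
        case False
        have "(T \<omega> / (v * u)) ^ K \<le> 1" if "T \<omega> \<le> v * u"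
          using that nn u v by (intro power_le_one) (auto simp: divide_le_eq_1)
        then show ?thesis using False \<omega> by (auto simp: indicator_def)
      qed
    qed
    also have "\<dots> = a u / 4 + Q u"
      unfolding a_def
    proof (subst Bochner_Integration.integral_add)
      show "integrable M (indicat_real {\<omega>\<in>space M. T \<omega> > u})"
        by (intro integrable_real_indicator) (auto simp: emeasure_eq_measure)
      have "{\<omega>\<in>space M. T \<omega> > u} \<inter> space M = {\<omega>\<in>space M. T \<omega> > u}" by auto
      then show "(\<integral>\<omega>. (indicator {\<omega>\<in>space M. T \<omega> \<le> u} \<omega> * (T \<omega> / u) ^ K) / 4 \<partial>M)
        + (\<integral>\<omega>. indicator {\<omega>\<in>space M. T \<omega> > u} \<omega> \<partial>M)
        = (\<integral>\<omega>. indicator {\<omega>\<in>space M. T \<omega> \<le> u} \<omega> * (T \<omega> / u) ^ K \<partial>M) / 4 + Q u"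
        by (simp add: Q_def)
    qed (intro integrable_divide_zero truncated_power_integrable)
    finally show ?thesis .
  qed
  have base: "a x \<le> C * Q x" if x: "x0 \<le> x" "x \<le> v * x0" for x
  proof -
    have "a x \<le> (\<integral>\<omega>. 1 \<partial>M)"
      unfolding a_def
    proof (rule integral_mono[OF truncated_power_integrable])
      fix \<omega> assume "\<omega> \<in> space M"
      then show "indicator {\<omega>\<in>space M. T \<omega> \<le> x} \<omega> * (T \<omega> / x) ^ K \<le> 1"
        using x v T_nonneg[of \<omega>] by (auto simp: indicator_def divide_le_eq_1 intro!: power_le_one)
    qed simp
    also have "\<dots> = 1" by (simp add: prob_space)
    also have "\<dots> = 1 / Q (v * x0) * Q (v * x0)" using Q_pos[of "v * x0"] v by simp
    also have "\<dots> \<le> C * Q x"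
      using Q_antimono[OF x(2)] Q_pos[of "v * x0"] v by (intro mult_mono) (auto simp: C_def)
    finally show ?thesis .
  qed
  \<comment> \<open>The factor 1/4 in \<open>step\<close> beats the factor 2 lost in doubling, so \<open>C\<close> survives \<open>x \<mapsto> v x\<close>.\<close>
  have claim: "a x \<le> C * Q x" if "x0 \<le> x" "x \<le> x0 * v ^ Suc l" for x l
    using that
  proof (induction l arbitrary: x)
    case 0
    then show ?case by (intro base) (simp_all add: mult.commute)
  next
    case (Suc l)
    show ?case
    proof (cases "x \<le> v * x0")
      case True
      with Suc.prems show ?thesis by (intro base)
    next
      case False
      define u where "u = x / v"
      have x: "x = v * u" using v by (simp add: u_def)
      have u: "x0 \<le> u" "u \<le> x0 * v ^ Suc l" "u > 0"
        using False Suc.prems v by (auto simp: u_def field_simps)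
      have "a x \<le> a u / 4 + Q u" unfolding x by (rule step[OF u(3)])
      also have "\<dots> \<le> (C / 4 + 1) * Q u" using Suc.IH[OF u(1,2)] by (simp add: algebra_simps)
      also have "\<dots> \<le> (C / 4 + 1) * (2 * Q x)"
        using dbl[OF u(1)] unfolding x by (intro mult_left_mono) (auto simp: C_def)
      also have "\<dots> = (C / 2 + 2) * Q x" by (simp add: algebra_simps)
      also have "\<dots> \<le> C * Q x"
        using Q_pos[of x] u x v C4 by (intro mult_right_mono) auto
      finally show ?thesis .
    qed
  qed
  have "\<forall>\<^sub>F x in at_top. a x \<le> C * Q x"
    using eventually_ge_at_top[of x0]
  proof eventually_elim
    case (elim x)
    obtain l where "x / x0 < v ^ l" using real_arch_pow[OF v(1)] by blast
    also have "v ^ l \<le> v ^ Suc l" using v by (intro power_increasing) auto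
    finally have "x \<le> x0 * v ^ Suc l" using v(2) by (simp add: field_simps)
    then show ?case using elim by (intro claim)
  qed
  then show thesis using K1 unfolding a_def by (intro that[of K C]) (auto simp: C_def)
qed

end

text \<open>On \<open>N = n\<close> the random event is the fixed \<open>E n\<close>, so
  independence applies to each value separately; summing over \<open>n\<close> gives the
  expectation. The families need not be sigma-algebras, so \<open>UN\<close> asks directly for the
  sets that occur.\<close>

lemma (in prob_space) prob_independent_index:
  assumes ind: "indep_set \<A> \<B>"
    and N [measurable]: "N \<in> measurable M (count_space (UNIV :: nat set))"
    and U [measurable]: "U \<in> events"
    and UN: "\<And>n. U \<inter> {\<omega>\<in>space M. N \<omega> = n} \<in> \<A>" and E: "\<And>n. E n \<in> \<B>"
  shows "prob {\<omega>\<in>U. \<omega> \<in> E (N \<omega>)} = (\<integral>\<omega>. indicator U \<omega> * prob (E (N \<omega>)) \<partial>M)"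
proof -
  have E_M [measurable]: "E n \<in> events" for n
  proof -
    have "case_bool \<A> \<B> False \<subseteq> events"
      using ind unfolding indep_set_def indep_sets_def by blast
    with E show ?thesis by auto
  qed
  define W where "W n = U \<inter> {\<omega>\<in>space M. N \<omega> = n}" for n
  have W_M [measurable]: "W n \<in> events" for n unfolding W_def by measurable
  have U_space: "U \<subseteq> space M" by (rule sets.sets_into_space[OF U])
  have eq: "{\<omega>\<in>U. \<omega> \<in> E (N \<omega>)} = (\<Union>n. W n \<inter> E n)" using U_space by (auto simp: W_def)
  have "ennreal (prob {\<omega>\<in>U. \<omega> \<in> E (N \<omega>)}) = (\<Sum>n. emeasure M (W n \<inter> E n))"
    unfolding eq emeasure_eq_measure[symmetric]
    by (intro suminf_emeasure[symmetric]) (auto simp: disjoint_family_on_def W_def)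
  also have "\<dots> = (\<Sum>n. \<integral>\<^sup>+\<omega>. ennreal (prob (E n)) * indicator (W n) \<omega> \<partial>M)"
  proof (rule suminf_cong)
    fix n
    have "prob (W n \<inter> E n) = prob (W n) * prob (E n)"
      using indep_setD[OF ind UN E] unfolding W_def .
    then show "emeasure M (W n \<inter> E n) = (\<integral>\<^sup>+\<omega>. ennreal (prob (E n)) * indicator (W n) \<omega> \<partial>M)"
      by (subst nn_integral_cmult_indicator) (auto simp: emeasure_eq_measure ennreal_mult mult.commute)
  qed
  also have "\<dots> = (\<integral>\<^sup>+\<omega>. (\<Sum>n. ennreal (prob (E n)) * indicator (W n) \<omega>) \<partial>M)"
    by (intro nn_integral_suminf[symmetric]) measurable
  also have "\<dots> = (\<integral>\<^sup>+\<omega>. ennreal (indicator U \<omega> * prob (E (N \<omega>))) \<partial>M)"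
  proof (rule nn_integral_cong)
    fix \<omega> assume \<omega>: "\<omega> \<in> space M"
    have "(\<Sum>n. ennreal (prob (E n)) * indicator (W n) \<omega>) = (\<Sum>n\<in>{N \<omega>}. ennreal (prob (E n)) * indicator (W n) \<omega>)"
      by (intro suminf_finite) (auto simp: W_def)
    then show "(\<Sum>n. ennreal (prob (E n)) * indicator (W n) \<omega>) = ennreal (indicator U \<omega> * prob (E (N \<omega>)))"
      using \<omega> by (simp add: W_def indicator_def)
  qed
  also have "\<dots> = ennreal (\<integral>\<omega>. indicator U \<omega> * prob (E (N \<omega>)) \<partial>M)"
  proof (rule nn_integral_eq_integral)
    show "integrable M (\<lambda>\<omega>. indicator U \<omega> * prob (E (N \<omega>)))"
    proof (rule integrable_const_bound[of _ 1])
      have [measurable]: "(\<lambda>\<omega>. prob (E (N \<omega>))) \<in> borel_measurable M"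
        by (rule measurable_compose[OF N]) simp
      show "(\<lambda>\<omega>. indicator U \<omega> * prob (E (N \<omega>))) \<in> borel_measurable M" by measurable
    qed (auto simp: indicator_def)
  qed (auto simp: indicator_def)
  finally show ?thesis by (subst (asm) ennreal_inj) (auto intro!: Bochner_Integration.integral_nonneg)
qed

section \<open>The weak law\<close>

context markov_additive
begin

lemma kernel_uminus_measurable:
  "i < d \<Longrightarrow> j < d \<Longrightarrow> uminus \<in> borel_measurable (\<mu> i j)"
  by (simp add: measurable_cong_sets[OF kernel_sets refl])

lemma measure_distr_uminus:
  "i < d \<Longrightarrow> j < d \<Longrightarrow> B \<in> sets borel \<Longrightarrow>
    measure (distr (\<mu> i j) borel uminus) B = measure (\<mu> i j) (uminus -` B)"
  using measure_distr[OF kernel_uminus_measurable, of i j B] by (simp add: kernel_space)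

text \<open>Reflection turns the bound on upward climbs into a bound on downward deviations.\<close>

lemma markov_additive_uminus:
  "markov_additive M F d (\<lambda>n \<omega>. - X n \<omega>) J (\<lambda>i j. distr (\<mu> i j) borel uminus)"
proof (intro markov_additive.intro markov_additive_axioms.intro)
  fix i j assume ij: "i < d" "j < d"
  interpret \<mu>: finite_measure "\<mu> i j" using kernel_finite ij by simp
  show "finite_measure (distr (\<mu> i j) borel uminus)"
    by (rule \<mu>.finite_measure_distr[OF kernel_uminus_measurable[OF ij]])
  show "sets (distr (\<mu> i j) borel uminus) = sets borel" by simp
  show "integrable (distr (\<mu> i j) borel uminus) (\<lambda>y. y)"
    unfolding integrable_distr_eq[OF kernel_uminus_measurable[OF ij] measurable_ident_sets[OF refl]]
    using kernel_moment[OF ij] by (rule integrable_minus)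
  fix A n x assume A: "A \<in> sets (F n)"
  then have [measurable]: "A \<in> sets M" by (rule sets_F_M)
  have "prob (A \<inter> {\<omega>\<in>space M. J n \<omega> = i \<and> - X (Suc n) \<omega> \<le> x \<and> J (Suc n) \<omega> = j})
    = (\<integral>\<omega>. indicator (A \<inter> {\<omega>\<in>space M. J n \<omega> = i \<and> - X (Suc n) \<omega> \<le> x \<and> J (Suc n) \<omega> = j}) \<omega> \<partial>M)"
    by (subst Bochner_Integration.integral_indicator) (auto intro!: arg_cong[where f = prob])
  \<comment> \<open>After the sign change the half-line is closed on the left, so
    \<open>kernel\<close> does not apply directly; \<open>kernel_integral\<close> does, with its
    indicator as test function.\<close>
  also have "\<dots> = (\<integral>\<omega>. indicator (A \<inter> {\<omega>\<in>space M. J n \<omega> = i \<and> J (Suc n) \<omega> = j}) \<omega>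
      * indicator {-x..} (X (Suc n) \<omega>) \<partial>M)"
    by (intro Bochner_Integration.integral_cong) (auto simp: indicator_def)
  also have "\<dots> = prob (A \<inter> {\<omega>\<in>space M. J n \<omega> = i}) * measure (\<mu> i j) {-x..}"
    by (subst kernel_integral[OF A ij]) (auto simp: kernel_space[OF ij])
  also have "{-x..} = uminus -` {..x}" by auto
  also have "measure (\<mu> i j) \<dots> = measure (distr (\<mu> i j) borel uminus) {..x}"
    by (simp add: measure_distr_uminus[OF ij])
  finally show "prob (A \<inter> {\<omega>\<in>space M. J n \<omega> = i \<and> - X (Suc n) \<omega> \<le> x \<and> J (Suc n) \<omega> = j})
    = prob (A \<inter> {\<omega>\<in>space M. J n \<omega> = i}) * measure (distr (\<mu> i j) borel uminus) {..x}" .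
next
  fix i assume i: "i < d"
  have "(\<Sum>j<d. measure (distr (\<mu> i j) borel uminus) UNIV) = (\<Sum>j<d. measure (\<mu> i j) UNIV)"
  proof (rule sum.cong[OF refl])
    fix j assume "j \<in> {..<d}"
    then have ij: "i < d" "j < d" using i by auto
      show "measure (distr (\<mu> i j) borel uminus) UNIV = measure (\<mu> i j) UNIV"
      by (simp add: measure_distr_uminus[OF ij])
  qed
  then show "(\<Sum>j<d. measure (distr (\<mu> i j) borel uminus) UNIV) = 1"
    using kernel_mass[OF i] by simp
qed (use prob_space_axioms subalg F_mono J_adapted J_less X_adapted in auto)

text \<open>Falling below \<open>(h - \<eta>) * n\<close> is a climb of \<open>- X\<close> by more
  than \<open>\<eta> / 2 * n\<close> relative to the drift \<open>- h + \<eta> / 2\<close>: half of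
  \<open>\<eta>\<close> pays for the drift, half for the height. At a height \<open>z\<close>
  proportional to \<open>n\<close> the factor \<open>n / z\<close> is constant, so the bound
  vanishes with \<open>g\<close>.\<close>

lemma weak_law_lower:
  fixes f :: "nat \<Rightarrow> real"
  assumes drift: "\<And>i. i < d \<Longrightarrow> (\<Sum>j<d. \<integral>y. y \<partial>\<mu> i j)
      + (\<Sum>j<d. measure (\<mu> i j) UNIV * f j) - f i = h"
    and \<eta>: "\<eta> > 0" and \<theta>: "\<theta> > 0"
  shows "\<forall>\<^sub>F n in sequentially. prob {\<omega>\<in>space M. (\<Sum>l<n. X (Suc l) \<omega>) < (h - \<eta>) * real n} \<le> \<theta>"
proof -
  interpret neg: markov_additive M F d "\<lambda>n \<omega>. - X n \<omega>" J "\<lambda>i j. distr (\<mu> i j) borel uminus"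
    by (rule markov_additive_uminus)
  \<comment> \<open>\<open>- f\<close> solves the Poisson equation of \<open>- X\<close>, whose
    drift is \<open>- h\<close>.\<close>
  have drift': "(\<Sum>j<d. \<integral>y. y \<partial>distr (\<mu> i j) borel uminus)
      + (\<Sum>j<d. measure (distr (\<mu> i j) borel uminus) UNIV * - f j) - - f i = - h" if i: "i < d" for i
  proof -
    have "(\<Sum>j<d. \<integral>y. y \<partial>distr (\<mu> i j) borel uminus) = (\<Sum>j<d. - (\<integral>y. y \<partial>\<mu> i j))"
    proof (rule sum.cong[OF refl])
      fix j assume "j \<in> {..<d}"
      then have ij: "i < d" "j < d" using i by auto
          show "(\<integral>y. y \<partial>distr (\<mu> i j) borel uminus) = - (\<integral>y. y \<partial>\<mu> i j)"
        unfolding integral_distr[OF kernel_uminus_measurable[OF ij] measurable_ident_sets[OF refl]]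
        by (rule Bochner_Integration.integral_minus)
    qed
    moreover have "(\<Sum>j<d. measure (distr (\<mu> i j) borel uminus) UNIV * - f j)
      = (\<Sum>j<d. - (measure (\<mu> i j) UNIV * f j))"
    proof (rule sum.cong[OF refl])
      fix j assume "j \<in> {..<d}"
      then have ij: "i < d" "j < d" using i by auto
          show "measure (distr (\<mu> i j) borel uminus) UNIV * - f j = - (measure (\<mu> i j) UNIV * f j)"
        by (simp add: measure_distr_uminus[OF ij])
    qed
    ultimately show ?thesis using drift[OF i] by (simp add: sum_negf)
  qed
  have "\<exists>g. (g \<longlongrightarrow> 0) at_top \<and> (\<forall>\<^sub>F z in at_top. \<forall>m n A. A \<in> sets (F m) \<longrightarrow> m \<le> n \<longrightarrow>
      prob (A \<inter> {\<omega>\<in>space M. \<exists>k\<in>{m..n}. z < (\<Sum>l=m..<k. - X (Suc l) \<omega> - (- h + \<eta> / 2))})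
      \<le> real (n - m) * g z / z * prob A)"
    by (rule neg.drift_maximal[where f = "\<lambda>i. - f i", OF drift' half_gt_zero[OF \<eta>]])
  then obtain g where g: "(g \<longlongrightarrow> 0) at_top"
    and bound: "\<forall>\<^sub>F z in at_top. \<forall>m n A. A \<in> sets (F m) \<longrightarrow> m \<le> n \<longrightarrow>
      prob (A \<inter> {\<omega>\<in>space M. \<exists>k\<in>{m..n}. z < (\<Sum>l=m..<k. - X (Suc l) \<omega> - (- h + \<eta> / 2))})
      \<le> real (n - m) * g z / z * prob A"
    by (elim exE conjE)
  have "\<forall>\<^sub>F z in at_top. g z < \<eta> / 2 * \<theta>"
    using \<eta> \<theta> by (intro order_tendstoD(2)[OF g]) auto
  moreover have lim: "filterlim (\<lambda>n. \<eta> / 2 * real n) at_top sequentially"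
    using \<eta> by (intro filterlim_tendsto_pos_mult_at_top[OF tendsto_const _ filterlim_real_sequentially]) auto
  ultimately have "\<forall>\<^sub>F n in sequentially. g (\<eta> / 2 * real n) < \<eta> / 2 * \<theta>"
    by (rule eventually_compose_filterlim)
  moreover note eventually_compose_filterlim[OF bound lim]
  moreover note eventually_gt_at_top[of "0::nat"]
  ultimately show ?thesis
  proof eventually_elim
    case (elim n)
    define z where "z = \<eta> / 2 * real n"
    have z: "z > 0" using elim(3) \<eta> by (simp add: z_def)
    have "prob {\<omega>\<in>space M. (\<Sum>l<n. X (Suc l) \<omega>) < (h - \<eta>) * real n}
      \<le> prob (space M \<inter> {\<omega>\<in>space M. \<exists>k\<in>{0..n}. z < (\<Sum>l=0..<k. - X (Suc l) \<omega> - (- h + \<eta> / 2))})"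
    proof (rule finite_measure_mono)
      show "{\<omega>\<in>space M. (\<Sum>l<n. X (Suc l) \<omega>) < (h - \<eta>) * real n}
        \<subseteq> space M \<inter> {\<omega>\<in>space M. \<exists>k\<in>{0..n}. z < (\<Sum>l=0..<k. - X (Suc l) \<omega> - (- h + \<eta> / 2))}"
      proof
        fix \<omega> assume \<omega>: "\<omega> \<in> {\<omega>\<in>space M. (\<Sum>l<n. X (Suc l) \<omega>) < (h - \<eta>) * real n}"
        have "(\<Sum>l=0..<n. - X (Suc l) \<omega> - (- h + \<eta> / 2)) = - (\<Sum>l<n. X (Suc l) \<omega>) - real n * (- h + \<eta> / 2)"
          by (simp add: sum_subtractf sum_negf atLeast0LessThan)
        also have "\<dots> > z" using \<omega> by (simp add: z_def algebra_simps)
        finally show "\<omega> \<in> space M \<inter> {\<omega>\<in>space M. \<exists>k\<in>{0..n}. z < (\<Sum>l=0..<k. - X (Suc l) \<omega> - (- h + \<eta> / 2))}"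
          using \<omega> by auto
      qed
    qed measurable
    also have "\<dots> \<le> real (n - 0) * g z / z * prob (space M)"
      using sets.top[of "F 0"] unfolding z_def space_F by (intro elim(2)[rule_format]) simp_all
    also have "\<dots> = g z / (\<eta> / 2)"
      using elim(3) \<eta> by (simp add: z_def prob_space)
    also have "\<dots> \<le> \<theta>"
      using elim(1) \<eta> by (simp add: z_def field_simps)
    finally show ?case .
  qed
qed

end

section \<open>Evaluation at an independent random time\<close>

lemma mapS_eq: "mapS X n \<omega> = X 0 \<omega> + (\<Sum>l<n. X (Suc l) \<omega>)"
  unfolding mapS_def by (simp add: sum.atMost_shift)

lemma mapM_gt_iff: "c < mapM X n \<omega> \<longleftrightarrow> (\<exists>k\<le>n. c < mapS X k \<omega>)"
  unfolding mapM_def by (subst Max_gr_iff) auto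

lemma mapS_le_mapM: "mapS X n \<omega> \<le> mapM X n \<omega>"
  unfolding mapM_def by (intro Max_ge) auto

text \<open>\<open>PR\<close> supplies a sigma-algebra independent of \<open>T\<close> that makes
  every \<open>X n\<close> measurable; in the application it is generated by the whole trajectory.
  \<open>f\<close> is the solution of the Poisson equation.\<close>

locale map_random_time = markov_additive M F d X J \<mu> + classC_tail M T
  for M :: "'a measure" and F d X J \<mu> T +
  fixes PR :: "'a measure" and f :: "nat \<Rightarrow> real" and h :: real
  assumes poisson: "\<And>i. i < d \<Longrightarrow> (\<Sum>j<d. \<integral>y. y \<partial>\<mu> i j)
      + (\<Sum>j<d. measure (\<mu> i j) UNIV * f j) - f i = h"
    and h_pos: "h > 0" and T_int: "integrable M T"
    and space_PR: "space PR = space M" and X_PR: "X n \<in> borel_measurable PR"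
    and indep_PR: "indep_set {T -` B \<inter> space M | B. B \<in> sets borel} (sets PR)"
    and initial_tail: "(\<lambda>x. prob {\<omega>\<in>space M. x < \<bar>X 0 \<omega>\<bar>}) \<in> o[at_top](Q)"
    and jump_tail_small: "jump_tail \<in> o[at_top](Q)"
begin

definition N :: "'a \<Rightarrow> nat" where
  "N \<omega> = nat \<lfloor>T \<omega>\<rfloor>"

lemma N_M [measurable]: "N \<in> measurable M (count_space UNIV)"
  unfolding N_def by measurable

lemma N_le: "\<omega> \<in> space M \<Longrightarrow> real (N \<omega>) \<le> T \<omega>"
  unfolding N_def using T_nonneg by simp

lemma N_gt: "\<omega> \<in> space M \<Longrightarrow> T \<omega> < real (N \<omega>) + 1"
  unfolding N_def using T_nonneg[of \<omega>] by (simp add: of_nat_nat)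

lemma mapS_PR [measurable]: "mapS X n \<in> borel_measurable PR"
  unfolding mapS_def[abs_def] using X_PR by measurable

lemma mapS_M [measurable]: "mapS X n \<in> borel_measurable M"
  unfolding mapS_def[abs_def] by measurable

lemma mapM_M [measurable]: "mapM X n \<in> borel_measurable M"
  unfolding mapM_def[abs_def] by measurable

lemma mapS_N_M [measurable]: "(\<lambda>\<omega>. mapS X (N \<omega>) \<omega>) \<in> borel_measurable M"
  by (rule measurable_compose_countable[OF _ N_M]) simp

lemma mapM_N_M [measurable]: "(\<lambda>\<omega>. mapM X (N \<omega>) \<omega>) \<in> borel_measurable M"
  by (rule measurable_compose_countable[OF _ N_M]) simp

lemma prob_at_N:
  assumes [measurable]: "V \<in> sets borel" and E: "\<And>n. E n \<in> sets PR"
  shows "prob {\<omega>\<in>space M. T \<omega> \<in> V \<and> \<omega> \<in> E (N \<omega>)}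
    = (\<integral>\<omega>. indicator {\<omega>\<in>space M. T \<omega> \<in> V} \<omega> * prob (E (N \<omega>)) \<partial>M)"
proof -
  have "{\<omega>\<in>space M. T \<omega> \<in> V} \<inter> {\<omega>\<in>space M. N \<omega> = n} \<in> {T -` B \<inter> space M | B. B \<in> sets borel}" for n
  proof -
    have "{\<omega>\<in>space M. T \<omega> \<in> V} \<inter> {\<omega>\<in>space M. N \<omega> = n}
      = T -` (V \<inter> {t. nat \<lfloor>t\<rfloor> = n}) \<inter> space M" by (auto simp: N_def)
    moreover have "V \<inter> {t::real. nat \<lfloor>t\<rfloor> = n} \<in> sets borel" by measurable
    ultimately show ?thesis by blast
  qed
  from prob_independent_index[OF indep_PR N_M _ this E]
  have "prob {\<omega>\<in>{\<omega>\<in>space M. T \<omega> \<in> V}. \<omega> \<in> E (N \<omega>)}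
    = (\<integral>\<omega>. indicator {\<omega>\<in>space M. T \<omega> \<in> V} \<omega> * prob (E (N \<omega>)) \<partial>M)"
    by simp
  then show ?thesis by (simp add: conj_assoc)
qed

lemma small_tail:
  assumes g: "g \<in> o[at_top](Q)" and \<delta>: "\<delta> > 0" and \<epsilon>: "\<epsilon> > 0"
  shows "\<forall>\<^sub>F x in at_top. \<bar>g (\<delta> * x)\<bar> \<le> \<epsilon> * Q x"
proof -
  obtain C where C: "C > 0" "\<forall>\<^sub>F x in at_top. Q (\<delta> * x) \<le> C * Q x"
    by (rule Q_scale[OF \<delta>])
  have "\<forall>\<^sub>F x in at_top. norm (g x) \<le> \<epsilon> / C * norm (Q x)"
    using landau_o.smallD[OF g, of "\<epsilon> / C"] C \<epsilon> by simp
  moreover have "filterlim (\<lambda>x. \<delta> * x) at_top at_top"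
    using \<delta> by (intro filterlim_tendsto_pos_mult_at_top[OF tendsto_const _ filterlim_ident]) auto
  ultimately have "\<forall>\<^sub>F x in at_top. norm (g (\<delta> * x)) \<le> \<epsilon> / C * norm (Q (\<delta> * x))"
    by (rule eventually_compose_filterlim)
  with C(2) show ?thesis
  proof eventually_elim
    case (elim x)
    have "Q (\<delta> * x) \<ge> 0" unfolding Q_def by simp
    then have "\<bar>g (\<delta> * x)\<bar> \<le> \<epsilon> / C * Q (\<delta> * x)" using elim(2) by simp
    also have "\<dots> \<le> \<epsilon> / C * (C * Q x)" using elim(1) C(1) \<epsilon> by (intro mult_left_mono) auto
    finally show ?case using C(1) by simp
  qed
qed

lemma initial_tail_null:
  fixes \<epsilon> :: real
  assumes \<epsilon>: "\<epsilon> > 0"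
  shows "\<forall>\<^sub>F x in at_top. prob {\<omega>\<in>space M. x < \<bar>X 0 \<omega>\<bar>} \<le> \<epsilon>"
proof -
  have "\<forall>\<^sub>F x in at_top. \<bar>prob {\<omega>\<in>space M. 1 * x < \<bar>X 0 \<omega>\<bar>}\<bar> \<le> \<epsilon> * Q x"
    by (rule small_tail[OF initial_tail _ \<epsilon>]) simp
  then show ?thesis
  proof (rule eventually_mono)
    fix x assume "\<bar>prob {\<omega>\<in>space M. 1 * x < \<bar>X 0 \<omega>\<bar>}\<bar> \<le> \<epsilon> * Q x"
    moreover have "\<epsilon> * Q x \<le> \<epsilon> * 1" unfolding Q_def using \<epsilon> by (intro mult_left_mono) auto
    ultimately show "prob {\<omega>\<in>space M. x < \<bar>X 0 \<omega>\<bar>} \<le> \<epsilon>" by simp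
  qed
qed

lemma lower_bound:
  assumes \<epsilon>: "0 < \<epsilon>" "\<epsilon> < 1"
  shows "\<forall>\<^sub>F x in at_top. (1 - \<epsilon>) * Q x \<le> prob {\<omega>\<in>space M. h * x < mapS X (N \<omega>) \<omega>}"
proof -
  obtain v where v: "v > 1" "\<forall>\<^sub>F x in at_top. (1 - \<epsilon> / 2) * Q x \<le> Q (v * x)"
    using classC_ratio[OF T_C, of "\<epsilon> / 2"] \<epsilon> unfolding Q_def by auto
  \<comment> \<open>Chosen so that \<open>h - 2 * \<eta> = h * (v + 1) / (2 * v)\<close>. One
    \<open>\<eta>\<close> is spent on the weak law, the other on \<open>X 0\<close>.\<close>
  define \<eta> where "\<eta> = h * (v - 1) / (4 * v)"
  have \<eta>: "\<eta> > 0" unfolding \<eta>_def using h_pos v by simp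
  have "\<forall>\<^sub>F n in sequentially. prob {\<omega>\<in>space M. (\<Sum>l<n. X (Suc l) \<omega>) < (h - \<eta>) * real n} \<le> \<epsilon> / 4"
    using \<eta> \<epsilon> by (intro weak_law_lower[OF poisson]) auto
  moreover have "filterlim (\<lambda>n. \<eta> * real n) at_top sequentially"
    using \<eta> by (intro filterlim_tendsto_pos_mult_at_top[OF tendsto_const _ filterlim_real_sequentially]) auto
  then have "\<forall>\<^sub>F n in sequentially. prob {\<omega>\<in>space M. \<eta> * real n < \<bar>X 0 \<omega>\<bar>} \<le> \<epsilon> / 4"
    using \<epsilon> by (intro eventually_compose_filterlim[OF initial_tail_null]) auto
  \<comment> \<open>Absorbs the rounding of \<open>T\<close>: only \<open>v * x < n + 1\<close> is
    known, and for such \<open>n\<close> the right side is at most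
    \<open>n * (v + 1) / 2\<close>.\<close>
  moreover have "\<forall>\<^sub>F n in sequentially. 2 / (v - 1) \<le> real n"
    using filterlim_real_sequentially unfolding filterlim_at_top by blast
  ultimately have "\<forall>\<^sub>F n in sequentially. \<forall>x. v * x < real n + 1 \<longrightarrow>
    prob {\<omega>\<in>space M. mapS X n \<omega> \<le> h * x} \<le> \<epsilon> / 2"
  proof eventually_elim
    case (elim n)
    show ?case
    proof (intro allI impI)
      fix x assume x: "v * x < real n + 1"
      have "1 \<le> real n * (v - 1) / 2" using elim(3) v by (simp add: field_simps)
      then have "v * x < real n * (v + 1) / 2" using x by (simp add: algebra_simps add_divide_distrib diff_divide_distrib)
      then have "x < real n * (v + 1) / (2 * v)" using v by (simp add: field_simps)
      then have "h * x < h * (real n * (v + 1) / (2 * v))" using h_pos by (rule mult_strict_left_mono)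
      also have "\<dots> = (h - 2 * \<eta>) * real n" using v by (simp add: \<eta>_def field_simps)
      finally have hx: "h * x < (h - 2 * \<eta>) * real n" .
      have "prob {\<omega>\<in>space M. mapS X n \<omega> \<le> h * x}
        \<le> prob ({\<omega>\<in>space M. (\<Sum>l<n. X (Suc l) \<omega>) < (h - \<eta>) * real n} \<union> {\<omega>\<in>space M. \<eta> * real n < \<bar>X 0 \<omega>\<bar>})"
      proof (rule finite_measure_mono)
        show "{\<omega>\<in>space M. mapS X n \<omega> \<le> h * x} \<subseteq> {\<omega>\<in>space M. (\<Sum>l<n. X (Suc l) \<omega>) < (h - \<eta>) * real n}
          \<union> {\<omega>\<in>space M. \<eta> * real n < \<bar>X 0 \<omega>\<bar>}"
          using hx by (auto simp: mapS_eq algebra_simps abs_if)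
      qed measurable
      also have "\<dots> \<le> \<epsilon> / 4 + \<epsilon> / 4"
        by (intro order_trans[OF measure_Un_le] add_mono elim) measurable
      finally show "prob {\<omega>\<in>space M. mapS X n \<omega> \<le> h * x} \<le> \<epsilon> / 2" by simp
    qed
  qed
  then obtain n0 where n0: "\<And>n x. n0 \<le> n \<Longrightarrow> v * x < real n + 1 \<Longrightarrow>
    prob {\<omega>\<in>space M. mapS X n \<omega> \<le> h * x} \<le> \<epsilon> / 2"
    unfolding eventually_sequentially by blast
  from v(2) eventually_ge_at_top[of "(real n0 + 1) / v"] show ?thesis
  proof eventually_elim
    case (elim x)
    \<comment> \<open>Hence \<open>T > v * x\<close> forces \<open>N \<ge> n0\<close>, since
      \<open>T < N + 1\<close>.\<close>
    have vx: "real n0 + 1 \<le> v * x" using elim(2) v by (simp add: field_simps)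
    have "prob {\<omega>\<in>space M. T \<omega> \<in> {v * x<..} \<and> \<omega> \<in> {\<omega>\<in>space M. mapS X (N \<omega>) \<omega> \<le> h * x}}
      = (\<integral>\<omega>. indicator {\<omega>\<in>space M. T \<omega> \<in> {v * x<..}} \<omega> * prob {\<omega>'\<in>space M. mapS X (N \<omega>) \<omega>' \<le> h * x} \<partial>M)"
    proof -
      have "{\<omega>\<in>space M. mapS X n \<omega> \<le> h * x} \<in> sets PR" for n
        unfolding space_PR[symmetric] by measurable
      then show ?thesis
        using prob_at_N[of "{v * x<..}" "\<lambda>n. {\<omega>\<in>space M. mapS X n \<omega> \<le> h * x}"] by simp
    qed
    also have "\<dots> \<le> (\<integral>\<omega>. indicator {\<omega>\<in>space M. T \<omega> \<in> {v * x<..}} \<omega> * (\<epsilon> / 2) \<partial>M)"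
    proof (rule integral_mono)
      have [measurable]: "(\<lambda>\<omega>. prob {\<omega>'\<in>space M. mapS X (N \<omega>) \<omega>' \<le> h * x}) \<in> borel_measurable M"
        by (rule measurable_compose[OF N_M]) simp
      show "integrable M (\<lambda>\<omega>. indicator {\<omega>\<in>space M. T \<omega> \<in> {v * x<..}} \<omega> * prob {\<omega>'\<in>space M. mapS X (N \<omega>) \<omega>' \<le> h * x})"
        by (rule integrable_const_bound[of _ 1]) (auto simp: indicator_def)
      show "integrable M (\<lambda>\<omega>. indicator {\<omega>\<in>space M. T \<omega> \<in> {v * x<..}} \<omega> * (\<epsilon> / 2))"
        by (intro integrable_mult_left integrable_real_indicator) (auto simp: emeasure_eq_measure)
      fix \<omega> assume \<omega>: "\<omega> \<in> space M"
      have "prob {\<omega>'\<in>space M. mapS X (N \<omega>) \<omega>' \<le> h * x} \<le> \<epsilon> / 2" if "T \<omega> \<in> {v * x<..}"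
        using that N_gt[OF \<omega>] vx by (intro n0) auto
      then show "indicator {\<omega>\<in>space M. T \<omega> \<in> {v * x<..}} \<omega> * prob {\<omega>'\<in>space M. mapS X (N \<omega>) \<omega>' \<le> h * x}
        \<le> indicator {\<omega>\<in>space M. T \<omega> \<in> {v * x<..}} \<omega> * (\<epsilon> / 2)"
        by (auto simp: indicator_def)
    qed
    also have "\<dots> = \<epsilon> / 2 * Q (v * x)"
      by (simp add: Q_def Int_def conj_commute)
    finally have bad: "prob {\<omega>\<in>space M. v * x < T \<omega> \<and> mapS X (N \<omega>) \<omega> \<le> h * x} \<le> \<epsilon> / 2 * Q (v * x)"
      by (simp add: conj_commute cong: conj_cong)
    have "Q (v * x) \<le> prob ({\<omega>\<in>space M. h * x < mapS X (N \<omega>) \<omega>} \<union> {\<omega>\<in>space M. v * x < T \<omega> \<and> mapS X (N \<omega>) \<omega> \<le> h * x})"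
      unfolding Q_def by (rule finite_measure_mono) auto
    also have "\<dots> \<le> prob {\<omega>\<in>space M. h * x < mapS X (N \<omega>) \<omega>} + \<epsilon> / 2 * Q (v * x)"
      by (intro order_trans[OF measure_Un_le] add_left_mono bad) measurable
    finally have "(1 - \<epsilon> / 2) * Q (v * x) \<le> prob {\<omega>\<in>space M. h * x < mapS X (N \<omega>) \<omega>}"
      by (simp add: algebra_simps)
    moreover have "(1 - \<epsilon> / 2) * ((1 - \<epsilon> / 2) * Q x) \<le> (1 - \<epsilon> / 2) * Q (v * x)"
      using elim(1) \<epsilon> by (intro mult_left_mono) auto
    moreover have "(1 - \<epsilon>) * Q x \<le> (1 - \<epsilon> / 2) * ((1 - \<epsilon> / 2) * Q x)"
    proof -
      have "(1 - \<epsilon> / 2) * (1 - \<epsilon> / 2) = 1 - \<epsilon> + \<epsilon>\<^sup>2 / 4" by (simp add: power2_eq_square field_simps)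
      then have "1 - \<epsilon> \<le> (1 - \<epsilon> / 2) * (1 - \<epsilon> / 2)" by simp
      then show ?thesis unfolding mult.assoc[symmetric] by (intro mult_right_mono) (auto simp: Q_def)
    qed
    ultimately show ?case by linarith
  qed
qed

text \<open>If no jump exceeds \<open>z\<close>, each climb by \<open>z\<close> overshoots by at
  most \<open>z\<close>, so exceeding \<open>K * (2 * z)\<close> takes \<open>K\<close> successive
  climbs. The absolute value of \<open>g\<close> is taken because powers of the bound need a
  nonnegative base.\<close>

lemma jump_or_climb_bound:
  assumes bound: "\<And>m n A. A \<in> sets (F m) \<Longrightarrow> m \<le> n \<Longrightarrow>
      prob (A \<inter> {\<omega>\<in>space M. \<exists>k\<in>{m..n}. z < (\<Sum>l=m..<k. X (Suc l) \<omega> - c)})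
      \<le> real (n - m) * g / z * prob A"
    and z: "z > 0" and c: "c \<ge> 0"
  shows "prob {\<omega>\<in>space M. (\<exists>l<n. z < \<bar>X (Suc l) \<omega>\<bar>) \<or> (\<exists>k\<le>n. real K * (2 * z) < (\<Sum>l<k. X (Suc l) \<omega> - c))}
    \<le> real n * jump_tail z + (real n * \<bar>g\<bar> / z) ^ K"
proof -
  define A where "A = space M \<inter> {\<omega>\<in>space M. \<exists>l\<in>{0..<n}. z < \<bar>X (Suc l) \<omega>\<bar>}"
  define B where "B = space M \<inter> {\<omega>\<in>space M. (\<forall>l\<in>{0..<n}. X (Suc l) \<omega> \<le> z) \<and>
      (\<exists>k\<in>{0..n}. real K * (z + z) < (\<Sum>l=0..<k. X (Suc l) \<omega> - c))}"
  have sp: "space M \<in> sets (F 0)" using sets.top[of "F 0"] by (simp add: space_F)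
  have [measurable]: "A \<in> sets M" "B \<in> sets M" unfolding A_def B_def by measurable
  have "prob {\<omega>\<in>space M. (\<exists>l<n. z < \<bar>X (Suc l) \<omega>\<bar>) \<or> (\<exists>k\<le>n. real K * (2 * z) < (\<Sum>l<k. X (Suc l) \<omega> - c))}
    \<le> prob (A \<union> B)"
  proof (rule finite_measure_mono)
    show "{\<omega>\<in>space M. (\<exists>l<n. z < \<bar>X (Suc l) \<omega>\<bar>) \<or> (\<exists>k\<le>n. real K * (2 * z) < (\<Sum>l<k. X (Suc l) \<omega> - c))} \<subseteq> A \<union> B"
    proof
      fix \<omega> assume \<omega>: "\<omega> \<in> {\<omega>\<in>space M. (\<exists>l<n. z < \<bar>X (Suc l) \<omega>\<bar>) \<or> (\<exists>k\<le>n. real K * (2 * z) < (\<Sum>l<k. X (Suc l) \<omega> - c))}"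
      show "\<omega> \<in> A \<union> B"
      proof (cases "\<exists>l<n. z < \<bar>X (Suc l) \<omega>\<bar>")
        case False
        then have "\<forall>l\<in>{0..<n}. X (Suc l) \<omega> \<le> z" by force
        moreover from False \<omega> obtain k where "k \<le> n" "real K * (2 * z) < (\<Sum>l<k. X (Suc l) \<omega> - c)" by auto
        then have "\<exists>k\<in>{0..n}. real K * (z + z) < (\<Sum>l=0..<k. X (Suc l) \<omega> - c)"
          by (intro bexI[of _ k]) (auto simp: atLeast0LessThan)
        ultimately show ?thesis using \<omega> by (simp add: B_def)
      qed (use \<omega> in \<open>auto simp: A_def\<close>)
    qed
  qed measurable
  also have "\<dots> \<le> prob A + prob B" by (rule measure_Un_le) measurable
  also have "prob A \<le> real n * jump_tail z"
    unfolding A_def using jumps_bound[OF sp, of n z] by (simp add: prob_space)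
  also have "prob B \<le> (real n * \<bar>g\<bar> / z) ^ K * prob (space M)"
    unfolding B_def
  proof (rule iterated_climb[OF _ c _ sp])
    fix m A assume A: "A \<in> sets (F m)" and m: "m \<le> n"
    note bound[OF A m]
    also have "real (n - m) * g / z * prob A \<le> real n * \<bar>g\<bar> / z * prob A"
    proof (intro mult_right_mono divide_right_mono)
      have "real (n - m) * g \<le> real (n - m) * \<bar>g\<bar>" by (intro mult_left_mono) auto
      also have "\<dots> \<le> real n * \<bar>g\<bar>" by (intro mult_right_mono) auto
      finally show "real (n - m) * g \<le> real n * \<bar>g\<bar>" .
    qed (use z in auto)
    finally show "prob (A \<inter> {\<omega>\<in>space M. \<exists>k\<in>{m..n}. z < (\<Sum>l=m..<k. X (Suc l) \<omega> - c)})
      \<le> real n * \<bar>g\<bar> / z * prob A" .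
  qed (use z in auto)
  finally show ?thesis by (simp add: prob_space)
qed

lemma upper_bound:
  assumes \<epsilon>: "\<epsilon> > 0"
  shows "\<forall>\<^sub>F x in at_top. prob {\<omega>\<in>space M. h * x < mapM X (N \<omega>) \<omega>} \<le> (1 + \<epsilon>) * Q x"
proof -
  \<comment> \<open>Four losses of size \<open>e\<close>: one in
    \<open>Q (\<rho> * x) \<le> (1 + e) * Q x\<close>, and one each for the initial value, the large
    jumps and the climbs.\<close>
  define e where "e = \<epsilon> / 4"
  have e: "e > 0" using \<epsilon> by (simp add: e_def)
  \<comment> \<open>\<open>1 - e / (1 + e)\<close> is the reciprocal of \<open>1 + e\<close>. Read
    at \<open>\<rho> * x\<close> with \<open>v * \<rho> = 1\<close>, the inequality bounds
    \<open>Q (\<rho> * x)\<close> from above.\<close>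
  obtain v where v: "v > 1" "\<forall>\<^sub>F x in at_top. (1 - e / (1 + e)) * Q x \<le> Q (v * x)"
    using classC_ratio[OF T_C, of "e / (1 + e)"] e unfolding Q_def by auto
  define \<rho> where "\<rho> = 1 / v"
  have \<rho>: "0 < \<rho>" "\<rho> < 1" using v(1) by (auto simp: \<rho>_def)
  have lim_at_top: "filterlim (\<lambda>x. c * x) at_top at_top" if "c > 0" for c :: real
    using that by (intro filterlim_tendsto_pos_mult_at_top[OF tendsto_const _ filterlim_ident]) auto
  have Q\<rho>: "\<forall>\<^sub>F x in at_top. Q (\<rho> * x) \<le> (1 + e) * Q x"
  proof (rule eventually_mono[OF eventually_compose_filterlim[OF v(2) lim_at_top[OF \<rho>(1)]]])
    fix x assume "(1 - e / (1 + e)) * Q (\<rho> * x) \<le> Q (v * (\<rho> * x))"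
    moreover have "v * (\<rho> * x) = x" using v(1) by (simp add: \<rho>_def)
    moreover have "1 - e / (1 + e) = 1 / (1 + e)" using e by (simp add: field_simps)
    ultimately have "1 / (1 + e) * Q (\<rho> * x) \<le> Q x" by (simp only:)
    then show "Q (\<rho> * x) \<le> (1 + e) * Q x" using e by (simp add: field_simps)
  qed
  \<comment> \<open>By time \<open>\<rho> * x\<close> the raised drift \<open>h + \<eta>\<close>
    still falls short of \<open>h * x\<close> by \<open>2 * \<kappa> * x\<close>. One
    \<open>\<kappa> * x\<close> covers the initial value, the other is the height left to
    climb.\<close>
  define \<eta> where "\<eta> = h * (v - 1) / 2"
  define \<kappa> where "\<kappa> = h * (v - 1) / (4 * v)"
  have \<eta>: "\<eta> > 0" and \<kappa>: "\<kappa> > 0" using h_pos v(1) by (auto simp: \<eta>_def \<kappa>_def)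
  have gap: "h - (h + \<eta>) * \<rho> = 2 * \<kappa>" using v(1) by (simp add: \<eta>_def \<kappa>_def \<rho>_def field_simps)
  obtain K C where K: "K \<ge> 1" and C: "C > 0" and
    moment: "\<forall>\<^sub>F x in at_top. (\<integral>\<omega>. indicator {\<omega>\<in>space M. T \<omega> \<le> x} \<omega> * (T \<omega> / x) ^ K \<partial>M) \<le> C * Q x"
    by (rule truncated_power_moment)
  \<comment> \<open>\<open>K\<close> climbs with overshoot, each of total height
    \<open>2 * \<delta> * x\<close>, make up \<open>\<kappa> * x\<close>.\<close>
  define \<delta> where "\<delta> = \<kappa> / (2 * real K)"
  have \<delta>: "\<delta> > 0" using \<kappa> K by (simp add: \<delta>_def)
  have \<delta>\<kappa>: "\<delta> \<le> \<kappa>" using \<kappa> K by (simp add: \<delta>_def field_simps)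
  have K\<delta>: "real K * (2 * (\<delta> * x)) = \<kappa> * x" for x using K by (simp add: \<delta>_def)
  have "\<exists>g. (g \<longlongrightarrow> 0) at_top \<and> (\<forall>\<^sub>F z in at_top. \<forall>m n A. A \<in> sets (F m) \<longrightarrow> m \<le> n \<longrightarrow>
      prob (A \<inter> {\<omega>\<in>space M. \<exists>k\<in>{m..n}. z < (\<Sum>l=m..<k. X (Suc l) \<omega> - (h + \<eta>))})
      \<le> real (n - m) * g z / z * prob A)"
    by (rule drift_maximal[OF poisson \<eta>])
  then obtain g where g: "(g \<longlongrightarrow> 0) at_top" and
    climb: "\<forall>\<^sub>F z in at_top. \<forall>m n A. A \<in> sets (F m) \<longrightarrow> m \<le> n \<longrightarrow>
      prob (A \<inter> {\<omega>\<in>space M. \<exists>k\<in>{m..n}. z < (\<Sum>l=m..<k. X (Suc l) \<omega> - (h + \<eta>))})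
      \<le> real (n - m) * g z / z * prob A"
    by (elim exE conjE)
  \<comment> \<open>\<open>\<rho> / \<delta>\<close> converts \<open>T / z\<close> with
    \<open>z = \<delta> * x\<close> into \<open>T / (\<rho> * x)\<close>, the normalisation of the
    truncated moment.\<close>
  define b where "b z = (\<bar>g z\<bar> * (\<rho> / \<delta>)) ^ K" for z
  have "((\<lambda>z. (\<bar>g z\<bar> * (\<rho> / \<delta>)) ^ K) \<longlongrightarrow> (\<bar>0\<bar> * (\<rho> / \<delta>)) ^ K) at_top"
    by (intro tendsto_intros g)
  then have b0: "(b \<longlongrightarrow> 0) at_top" using K by (simp add: b_def[abs_def] zero_power)
  define ET where "ET = (\<integral>\<omega>. T \<omega> \<partial>M)"
  have ET: "ET \<ge> 0" unfolding ET_def using T_nonneg by (intro Bochner_Integration.integral_nonneg)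
  \<comment> \<open>With \<open>ET + 1\<close> the denominator is positive from
    \<open>ET \<ge> 0\<close> alone.\<close>
  have "\<forall>\<^sub>F x in at_top. \<bar>jump_tail (\<delta> * x)\<bar> \<le> e / (ET + 1) * Q x"
    using e ET by (intro small_tail jump_tail_small \<delta>) auto
  moreover have "\<forall>\<^sub>F x in at_top. \<bar>prob {\<omega>\<in>space M. \<delta> * x < \<bar>X 0 \<omega>\<bar>}\<bar> \<le> e * Q x"
    by (rule small_tail[OF initial_tail \<delta> e])
  \<comment> \<open>Compensates the moment constant \<open>C\<close> and the factor
    \<open>1 + e\<close> lost in passing from \<open>Q (\<rho> * x)\<close> to
    \<open>Q x\<close>.\<close>
  moreover have "\<forall>\<^sub>F x in at_top. b (\<delta> * x) < e / (C * (1 + e))"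
    using C e by (intro eventually_compose_filterlim[OF order_tendstoD(2)[OF b0] lim_at_top[OF \<delta>]]) auto
  moreover note eventually_compose_filterlim[OF moment lim_at_top[OF \<rho>(1)]]
  moreover note eventually_compose_filterlim[OF climb lim_at_top[OF \<delta>]]
  moreover note Q\<rho>
  moreover note eventually_gt_at_top[of "0::real"]
  ultimately show ?thesis
  proof eventually_elim
    case (elim x)
    note x = elim(7)
    define z where "z = \<delta> * x"
    have z: "z > 0" using x \<delta> by (simp add: z_def)
    define E where "E n = {\<omega>\<in>space M. (\<exists>l<n. z < \<bar>X (Suc l) \<omega>\<bar>) \<or>
      (\<exists>k\<le>n. real K * (2 * z) < (\<Sum>l<k. X (Suc l) \<omega> - (h + \<eta>)))}" for n
    define a where "a \<omega> = indicator {\<omega>\<in>space M. T \<omega> \<le> \<rho> * x} \<omega> * (T \<omega> / (\<rho> * x)) ^ K" for \<omega>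
    have E_PR: "E n \<in> sets PR" for n
    proof -
      note [measurable] = X_PR
      have "{\<omega>\<in>space PR. (\<exists>l<n. z < \<bar>X (Suc l) \<omega>\<bar>) \<or>
        (\<exists>k\<le>n. real K * (2 * z) < (\<Sum>l<k. X (Suc l) \<omega> - (h + \<eta>)))} \<in> sets PR" by measurable
      then show ?thesis unfolding E_def space_PR .
    qed
    have E_prob: "prob (E n) \<le> real n * jump_tail z + (real n * \<bar>g z\<bar> / z) ^ K" for n
      unfolding E_def
    proof (rule jump_or_climb_bound[OF _ z])
      show "h + \<eta> \<ge> 0" using h_pos \<eta> by simp
      show "prob (A \<inter> {\<omega>\<in>space M. \<exists>k\<in>{m..n}. z < (\<Sum>l=m..<k. X (Suc l) \<omega> - (h + \<eta>))})
        \<le> real (n - m) * g z / z * prob A" if "A \<in> sets (F m)" "m \<le> n" for m n A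
        using elim(5)[rule_format, OF that] unfolding z_def .
    qed
    have a_int: "integrable M a" unfolding a_def by (rule truncated_power_integrable)
    have "prob {\<omega>\<in>space M. T \<omega> \<in> {..\<rho> * x} \<and> \<omega> \<in> E (N \<omega>)}
      = (\<integral>\<omega>. indicator {\<omega>\<in>space M. T \<omega> \<in> {..\<rho> * x}} \<omega> * prob (E (N \<omega>)) \<partial>M)"
      by (rule prob_at_N[OF _ E_PR]) simp
    also have "\<dots> \<le> (\<integral>\<omega>. T \<omega> * jump_tail z + a \<omega> * b z \<partial>M)"
    proof (rule integral_mono)
      have [measurable]: "(\<lambda>\<omega>. prob (E (N \<omega>))) \<in> borel_measurable M"
        by (rule measurable_compose[OF N_M]) simp
      show "integrable M (\<lambda>\<omega>. indicator {\<omega>\<in>space M. T \<omega> \<in> {..\<rho> * x}} \<omega> * prob (E (N \<omega>)))"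
        by (rule integrable_const_bound[of _ 1]) (auto simp: indicator_def)
      show "integrable M (\<lambda>\<omega>. T \<omega> * jump_tail z + a \<omega> * b z)"
        using T_int a_int by auto
      fix \<omega> assume \<omega>: "\<omega> \<in> space M"
      show "indicator {\<omega>\<in>space M. T \<omega> \<in> {..\<rho> * x}} \<omega> * prob (E (N \<omega>)) \<le> T \<omega> * jump_tail z + a \<omega> * b z"
      proof (cases "T \<omega> \<le> \<rho> * x")
        case True
        have "prob (E (N \<omega>)) \<le> real (N \<omega>) * jump_tail z + (real (N \<omega>) * \<bar>g z\<bar> / z) ^ K" by (rule E_prob)
        also have "\<dots> \<le> T \<omega> * jump_tail z + (T \<omega> * \<bar>g z\<bar> / z) ^ K"
          using N_le[OF \<omega>] z jump_tail_nonneg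
          by (intro add_mono mult_right_mono power_mono divide_right_mono) auto
        also have "T \<omega> * \<bar>g z\<bar> / z = (T \<omega> / (\<rho> * x)) * (\<bar>g z\<bar> * (\<rho> / \<delta>))"
          using \<rho> \<delta> x by (simp add: z_def)
        also have "\<dots> ^ K = (T \<omega> / (\<rho> * x)) ^ K * b z"
          unfolding b_def by (rule power_mult_distrib)
        also have "\<dots> = a \<omega> * b z" using True \<omega> by (simp add: a_def)
        finally show ?thesis using True \<omega> by simp
      next
        case False
        then show ?thesis using T_nonneg[OF \<omega>] jump_tail_nonneg[of z] by (simp add: a_def)
      qed
    qed
    also have "\<dots> = ET * jump_tail z + (\<integral>\<omega>. a \<omega> \<partial>M) * b z"
      using T_int a_int unfolding ET_def by (subst Bochner_Integration.integral_add) auto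
    also have "ET * jump_tail z \<le> e * Q x"
    proof -
      have "ET * jump_tail z \<le> (ET + 1) * jump_tail z"
        using jump_tail_nonneg[of z] by (intro mult_right_mono) auto
      also have "\<dots> \<le> (ET + 1) * (e / (ET + 1) * Q x)"
        using elim(1) ET unfolding z_def by (intro mult_left_mono) auto
      finally show ?thesis using ET by simp
    qed
    also have "(\<integral>\<omega>. a \<omega> \<partial>M) * b z \<le> e * Q x"
    proof -
      have b_nonneg: "b z \<ge> 0" unfolding b_def using \<rho> \<delta> by auto
      have "(\<integral>\<omega>. a \<omega> \<partial>M) * b z \<le> (C * Q (\<rho> * x)) * b z"
        using elim(4) b_nonneg unfolding a_def by (intro mult_right_mono) auto
      also have "\<dots> \<le> (C * ((1 + e) * Q x)) * b z"
        using elim(6) C b_nonneg by (intro mult_right_mono mult_left_mono) auto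
      also have "\<dots> \<le> (C * ((1 + e) * Q x)) * (e / (C * (1 + e)))"
        using elim(3) C e Q_pos[of x] x unfolding z_def by (intro mult_left_mono) auto
      also have "\<dots> = e * Q x" using C e by simp
      finally show ?thesis .
    qed
    finally have bad: "prob {\<omega>\<in>space M. T \<omega> \<in> {..\<rho> * x} \<and> \<omega> \<in> E (N \<omega>)} \<le> e * Q x + e * Q x"
      by simp
    have [measurable]: "{\<omega>\<in>space M. T \<omega> \<in> {..\<rho> * x} \<and> \<omega> \<in> E (N \<omega>)} \<in> sets M"
    proof -
      have [measurable]: "E n \<in> sets M" for n unfolding E_def by measurable
      have "{\<omega>\<in>space M. T \<omega> \<in> {..\<rho> * x} \<and> \<omega> \<in> E (N \<omega>)}
        = {\<omega>\<in>space M. T \<omega> \<le> \<rho> * x \<and> (\<exists>n. N \<omega> = n \<and> \<omega> \<in> E n)}" by auto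
      also have "\<dots> \<in> sets M" by measurable
      finally show ?thesis .
    qed
    have "prob {\<omega>\<in>space M. h * x < mapM X (N \<omega>) \<omega>} \<le> prob ({\<omega>\<in>space M. \<rho> * x < T \<omega>} \<union>
      ({\<omega>\<in>space M. z < \<bar>X 0 \<omega>\<bar>} \<union> {\<omega>\<in>space M. T \<omega> \<in> {..\<rho> * x} \<and> \<omega> \<in> E (N \<omega>)}))"
    proof (rule finite_measure_mono)
      show "{\<omega>\<in>space M. h * x < mapM X (N \<omega>) \<omega>} \<subseteq> {\<omega>\<in>space M. \<rho> * x < T \<omega>} \<union>
        ({\<omega>\<in>space M. z < \<bar>X 0 \<omega>\<bar>} \<union> {\<omega>\<in>space M. T \<omega> \<in> {..\<rho> * x} \<and> \<omega> \<in> E (N \<omega>)})"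
      proof
        fix \<omega> assume "\<omega> \<in> {\<omega>\<in>space M. h * x < mapM X (N \<omega>) \<omega>}"
        then obtain k where \<omega>: "\<omega> \<in> space M" and k: "k \<le> N \<omega>" "h * x < mapS X k \<omega>"
          by (auto simp: mapM_gt_iff)
        have "\<omega> \<in> E (N \<omega>)" if T: "T \<omega> \<le> \<rho> * x" and X0: "\<bar>X 0 \<omega>\<bar> \<le> z"
        proof -
          have "real k \<le> \<rho> * x" using k(1) N_le[OF \<omega>] T by linarith
          then have "real k * (h + \<eta>) \<le> \<rho> * x * (h + \<eta>)"
            using h_pos \<eta> by (intro mult_right_mono) auto
          moreover have "h * x - \<rho> * x * (h + \<eta>) = 2 * \<kappa> * x"
            unfolding gap[symmetric] by (simp add: algebra_simps)
          moreover have "z \<le> \<kappa> * x" using \<delta>\<kappa> x by (simp add: z_def)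
          ultimately have "\<kappa> * x < (mapS X k \<omega> - X 0 \<omega>) - real k * (h + \<eta>)"
            using k(2) X0 by linarith
          then have "real K * (2 * z) < (\<Sum>l<k. X (Suc l) \<omega> - (h + \<eta>))"
            unfolding z_def K\<delta> by (simp add: mapS_eq sum_subtractf)
          then show ?thesis using \<omega> k(1) by (auto simp: E_def)
        qed
        then show "\<omega> \<in> {\<omega>\<in>space M. \<rho> * x < T \<omega>} \<union>
          ({\<omega>\<in>space M. z < \<bar>X 0 \<omega>\<bar>} \<union> {\<omega>\<in>space M. T \<omega> \<in> {..\<rho> * x} \<and> \<omega> \<in> E (N \<omega>)})"
          using \<omega> by auto
      qed
    qed measurable
    also have "\<dots> \<le> Q (\<rho> * x) + (e * Q x + (e * Q x + e * Q x))"
    proof (intro order_trans[OF measure_Un_le] add_mono bad)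
      show "prob {\<omega>\<in>space M. \<rho> * x < T \<omega>} \<le> Q (\<rho> * x)" by (simp add: Q_def)
      show "prob {\<omega>\<in>space M. z < \<bar>X 0 \<omega>\<bar>} \<le> e * Q x" using elim(2) by (simp add: z_def)
    qed measurable
    also have "\<dots> \<le> (1 + \<epsilon>) * Q x" using elim(6) by (simp add: e_def algebra_simps)
    finally show ?case .
  qed
qed

lemma tail_equivalence:
  assumes A: "\<And>\<epsilon>. 0 < \<epsilon> \<Longrightarrow> \<epsilon> < 1 \<Longrightarrow> \<forall>\<^sub>F x in at_top. (1 - \<epsilon>) * Q x \<le> A x \<and> A x \<le> (1 + \<epsilon>) * Q x"
  shows "((\<lambda>x. A x / Q x) \<longlongrightarrow> 1) at_top"
proof (rule tendstoI)
  fix e :: real assume e: "e > 0"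
  define \<epsilon> where "\<epsilon> = min (e / 2) (1 / 2)"
  have \<epsilon>: "0 < \<epsilon>" "\<epsilon> < 1" "\<epsilon> < e" using e by (auto simp: \<epsilon>_def min_def)
  from A[OF \<epsilon>(1,2)] eventually_ge_at_top[of 0]
  show "\<forall>\<^sub>F x in at_top. dist (A x / Q x) 1 < e"
  proof eventually_elim
    case (elim x)
    have "1 - \<epsilon> \<le> A x / Q x" "A x / Q x \<le> 1 + \<epsilon>"
      using elim Q_pos[of x] by (auto simp: field_simps)
    then show ?case using \<epsilon> by (simp add: dist_real_def abs_less_iff)
  qed
qed

text \<open>As S \<le> M, the lower bound for S and the upper bound for M enclose both
  probabilities.\<close>

lemma random_time_asymptotics:
  "(\<lambda>x. prob {\<omega>\<in>space M. h * x < mapS X (N \<omega>) \<omega>}) \<sim>[at_top] (\<lambda>x. prob {\<omega>\<in>space M. h * x < mapM X (N \<omega>) \<omega>})"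
  (is "?A \<sim>[_] ?B")
  "(\<lambda>x. prob {\<omega>\<in>space M. h * x < mapM X (N \<omega>) \<omega>}) \<sim>[at_top] Q"
proof -
  have le: "?A x \<le> ?B x" for x
    by (rule finite_measure_mono) (auto intro: less_le_trans[OF _ mapS_le_mapM])
  have "((\<lambda>x. ?A x / Q x) \<longlongrightarrow> 1) at_top" "((\<lambda>x. ?B x / Q x) \<longlongrightarrow> 1) at_top"
  proof (rule_tac [!] tail_equivalence)
    fix \<epsilon> :: real assume \<epsilon>: "0 < \<epsilon>" "\<epsilon> < 1"
    from lower_bound[OF \<epsilon>] upper_bound[OF \<epsilon>(1)]
    show "\<forall>\<^sub>F x in at_top. (1 - \<epsilon>) * Q x \<le> ?A x \<and> ?A x \<le> (1 + \<epsilon>) * Q x"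
      by eventually_elim (use le in \<open>auto intro: order_trans\<close>)
    from lower_bound[OF \<epsilon>] upper_bound[OF \<epsilon>(1)]
    show "\<forall>\<^sub>F x in at_top. (1 - \<epsilon>) * Q x \<le> ?B x \<and> ?B x \<le> (1 + \<epsilon>) * Q x"
      by eventually_elim (use le in \<open>auto intro: order_trans\<close>)
  qed
  then have "?A \<sim>[at_top] Q" "?B \<sim>[at_top] Q" by (auto intro: asymp_equivI')
  then show "?A \<sim>[at_top] ?B" "?B \<sim>[at_top] Q"
    by (auto intro: asymp_equiv_trans asymp_equiv_symI)
qed

end

section \<open>From distribution functions and past events to the abstract setting\<close>

theorem theorem3p5:
  fixes M :: "'a measure"
    and d :: nat
    and X :: "nat \<Rightarrow> 'a \<Rightarrow> real"
    and J :: "nat \<Rightarrow> 'a \<Rightarrow> nat"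
    and H :: "nat \<Rightarrow> nat \<Rightarrow> real \<Rightarrow> real"
    and Hinf :: "nat \<Rightarrow> nat \<Rightarrow> real"
    and w :: "nat \<Rightarrow> real"
    and h :: real
    and T :: "'a \<Rightarrow> real"
  assumes P: "prob_space M"
    and d_pos: "d > 0"
    and X_meas: "\<And>n. X n \<in> borel_measurable M"
    and J_meas: "\<And>n. J n \<in> measurable M (count_space UNIV)"
    and J_range: "\<And>n \<omega>. \<omega> \<in> space M \<Longrightarrow> J n \<omega> < d"
    \<comment> \<open>H i j are (defective) distribution functions with total masses Hinf i j\<close>
    and H_mono: "\<And>i j. i < d \<Longrightarrow> j < d \<Longrightarrow> mono (H i j)"
    and H_rcont: "\<And>i j x. i < d \<Longrightarrow> j < d \<Longrightarrow> continuous (at_right x) (H i j)"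
    and H_bot: "\<And>i j. i < d \<Longrightarrow> j < d \<Longrightarrow> (H i j \<longlongrightarrow> 0) at_bot"
    and H_top: "\<And>i j. i < d \<Longrightarrow> j < d \<Longrightarrow> (H i j \<longlongrightarrow> Hinf i j) at_top"
    \<comment> \<open>Markov additive structure: conditionally on the past up to n and J_n = i,
        P(X_{n+1} <= x, J_{n+1} = j | ...) = H i j x\<close>
    and MAP: "\<And>n A i j x. A \<in> past_events M X J n \<Longrightarrow> i < d \<Longrightarrow> j < d \<Longrightarrow>
        measure M (A \<inter> {\<omega>\<in>space M. J n \<omega> = i \<and> X (Suc n) \<omega> \<le> x \<and> J (Suc n) \<omega> = j})
        = measure M (A \<inter> {\<omega>\<in>space M. J n \<omega> = i}) * H i j x"
    \<comment> \<open>H(infinity) is an irreducible stochastic matrix with stationary vector w\<close>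
    and Hinf_stoch: "stochastic_matrix d Hinf"
    and Hinf_irred: "irreducible_matrix d Hinf"
    and w_nonneg: "\<And>i. i < d \<Longrightarrow> w i \<ge> 0"
    and w_sum: "(\<Sum>i<d. w i) = 1"
    and w_stat: "\<And>j. j < d \<Longrightarrow> (\<Sum>i<d. w i * Hinf i j) = w j"
    \<comment> \<open>finite mean drift h in (0, infinity)\<close>
    and H_int: "\<And>i j. i < d \<Longrightarrow> j < d \<Longrightarrow> integrable (interval_measure (H i j)) (\<lambda>y. y)"
    and h_def: "h = (\<Sum>i<d. w i * (\<Sum>j<d. integral\<^sup>L (interval_measure (H i j)) (\<lambda>y. y)))"
    and h_pos: "h > 0"
    \<comment> \<open>T: nonnegative, independent of the process, in class C, finite mean\<close>
    and T_meas: "T \<in> borel_measurable M"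
    and T_indep: "prob_space.indep_set M
        {T -` B \<inter> space M | B. B \<in> sets borel}
        {(\<lambda>\<omega> n. (X n \<omega>, J n \<omega>)) -` B \<inter> space M | B.
           B \<in> sets (Pi\<^sub>M UNIV (\<lambda>_. borel \<Otimes>\<^sub>M count_space UNIV))}"
    and T_C: "classC M T"
    and T_int: "integrable M T"
    \<comment> \<open>tail conditions (entrywise)\<close>
    and beta_tail: "\<And>i. i < d \<Longrightarrow>
        (\<lambda>x. measure M {\<omega>\<in>space M. \<bar>X 0 \<omega>\<bar> > x \<and> J 0 \<omega> = i})
          \<in> o[at_top](\<lambda>x. measure M {\<omega>\<in>space M. T \<omega> > x})"
    and H_tail: "\<And>i j. i < d \<Longrightarrow> j < d \<Longrightarrow>
        (\<lambda>x. measure (interval_measure (H i j)) {y. \<bar>y\<bar> > x})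
          \<in> o[at_top](\<lambda>x. measure M {\<omega>\<in>space M. T \<omega> > x})"
  shows "((\<lambda>x. measure M {\<omega>\<in>space M. mapS X (nat \<lfloor>T \<omega>\<rfloor>) \<omega> > h * x})
           \<sim>[at_top] (\<lambda>x. measure M {\<omega>\<in>space M. mapM X (nat \<lfloor>T \<omega>\<rfloor>) \<omega> > h * x}) \<and>
         (\<lambda>x. measure M {\<omega>\<in>space M. mapM X (nat \<lfloor>T \<omega>\<rfloor>) \<omega> > h * x})
           \<sim>[at_top] (\<lambda>x. measure M {\<omega>\<in>space M. T \<omega> > x}))"
proof -
  interpret prob_space M by (rule P)
  define F where "F n = sigma (space M) (\<Union>k\<in>{..n}. {X k -` B \<inter> space M | B. B \<in> sets borel}
    \<union> {J k -` C \<inter> space M | C. True})" for n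
  define \<mu> where "\<mu> i j = interval_measure (H i j)" for i j
  \<comment> \<open>Its sets are exactly the trajectory events in \<open>T_indep\<close>, and each
    \<open>X n\<close> is measurable for it as a coordinate of the trajectory.\<close>
  define G where "G = vimage_algebra (space M) (\<lambda>\<omega> n. (X n \<omega>, J n \<omega>))
    (Pi\<^sub>M UNIV (\<lambda>_. borel \<Otimes>\<^sub>M count_space UNIV))"
  have space_F: "space (F n) = space M" for n
    unfolding F_def by (intro space_measure_of) auto
  have sets_F: "sets (F n) = past_events M X J n" for n
    unfolding F_def past_events_def by (intro sets_measure_of) auto
  have X_F: "X k \<in> borel_measurable (F n)" and J_F: "J k \<in> measurable (F n) (count_space UNIV)"
    if "k \<le> n" for k n
    using that unfolding measurable_def space_F sets_F past_events_def
    by (auto intro!: sigma_sets.Basic)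
  \<comment> \<open>Minimality of \<open>F n\<close> among sigma-algebras making the past
    measurable; it yields both that \<open>F n\<close> lies in \<open>M\<close> and that
    \<open>F\<close> increases.\<close>
  have F_least: "sets (F n) \<subseteq> sets N" if "space N = space M"
    "\<And>k. k \<le> n \<Longrightarrow> X k \<in> borel_measurable N" "\<And>k. k \<le> n \<Longrightarrow> J k \<in> measurable N (count_space UNIV)"
    for n and N :: "'a measure"
    unfolding sets_F past_events_def that(1)[symmetric]
    using that(2,3) by (intro sets.sigma_sets_subset) (auto simp: measurable_sets)
  have prob_mu: "finite_borel_measure (\<mu> i j)" "measure (\<mu> i j) UNIV = Hinf i j"
    "measure (\<mu> i j) {..x} = H i j x" if ij: "i < d" "j < d" for i j x
  proof -
    have nonneg: "0 \<le> Hinf i j" using Hinf_stoch ij unfolding stochastic_matrix_def by auto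
    show "finite_borel_measure (\<mu> i j)" unfolding \<mu>_def
      by (rule finite_borel_measure_interval_measure[OF monoD[OF H_mono[OF ij]] H_rcont[OF ij] H_bot[OF ij] H_top[OF ij] nonneg])
    show "measure (\<mu> i j) UNIV = Hinf i j" unfolding \<mu>_def measure_def
      by (subst interval_measure_UNIV[OF monoD[OF H_mono[OF ij]] H_rcont[OF ij] H_bot[OF ij] H_top[OF ij] nonneg])
        (use nonneg in auto)
    show "measure (\<mu> i j) {..x} = H i j x" unfolding \<mu>_def
      by (rule measure_interval_measure_Iic[OF monoD[OF H_mono[OF ij]] H_rcont[OF ij] H_bot[OF ij]])
  qed
  define m where "m i = (\<Sum>j<d. \<integral>y. y \<partial>\<mu> i j)" for i
  \<comment> \<open>The definition of \<open>h\<close> as a stationary mean is the solvability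
    condition of the Poisson equation for the centred mean jumps.\<close>
  have "(\<Sum>i<d. w i * (m i - h)) = 0"
    using h_def w_sum unfolding m_def \<mu>_def
    by (simp add: right_diff_distrib sum_subtractf sum_distrib_right[symmetric])
  then obtain f where f: "\<And>i. i < d \<Longrightarrow> f i - (\<Sum>j<d. Hinf i j * f j) = m i - h"
    using poisson_equation[OF Hinf_stoch Hinf_irred d_pos w_sum w_stat, of "\<lambda>i. m i - h"] by blast
  have map: "markov_additive M F d X J \<mu>"
  proof (intro markov_additive.intro markov_additive_axioms.intro P)
    show "subalgebra M (F n)" for n
      unfolding subalgebra_def space_F using F_least[of M n] X_meas J_meas by simp
    show "sets (F k) \<subseteq> sets (F n)" if "k \<le> n" for k n
      using that X_F J_F by (intro F_least space_F) auto
    show "finite_measure (\<mu> i j)" "sets (\<mu> i j) = sets borel" "integrable (\<mu> i j) (\<lambda>y. y)"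
      if "i < d" "j < d" for i j
      using prob_mu(1)[OF that] H_int[OF that] by (auto simp: finite_borel_measure_def \<mu>_def)
    show "(\<Sum>j<d. measure (\<mu> i j) UNIV) = 1" if "i < d" for i
      using that prob_mu(2)[OF that] Hinf_stoch by (simp add: stochastic_matrix_def)
    show "prob (A \<inter> {\<omega>\<in>space M. J n \<omega> = i \<and> X (Suc n) \<omega> \<le> x \<and> J (Suc n) \<omega> = j})
      = prob (A \<inter> {\<omega>\<in>space M. J n \<omega> = i}) * measure (\<mu> i j) {..x}"
      if "A \<in> sets (F n)" "i < d" "j < d" for A n i j x
      using MAP[of A n i j x] that prob_mu(3)[OF that(2,3)] by (simp add: sets_F)
  qed (use X_F J_F J_range in auto)
  interpret markov_additive M F d X J \<mu> by (rule map)
  interpret classC_tail M T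
    by (intro classC_tail.intro classC_tail_axioms.intro P T_meas T_C)
  have process_G: "(\<lambda>\<omega> n. (X n \<omega>, J n \<omega>)) \<in> measurable G (Pi\<^sub>M UNIV (\<lambda>_. borel \<Otimes>\<^sub>M count_space UNIV))"
    unfolding G_def by (rule measurable_vimage_algebra1) (auto simp: space_PiM space_pair_measure)
  have X_G: "X n \<in> borel_measurable G" for n
  proof -
    have "(\<lambda>\<omega>. fst ((\<lambda>n. (X n \<omega>, J n \<omega>)) n)) \<in> borel_measurable G"
      by (rule measurable_compose[OF measurable_compose[OF process_G measurable_component_singleton] measurable_fst])
        simp
    then show ?thesis by simp
  qed
  have sets_G: "sets G = {(\<lambda>\<omega> n. (X n \<omega>, J n \<omega>)) -` B \<inter> space M | B.
      B \<in> sets (Pi\<^sub>M UNIV (\<lambda>_. borel \<Otimes>\<^sub>M count_space UNIV))}"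
    unfolding G_def by (rule sets_vimage_algebra2) (auto simp: space_PiM space_pair_measure)
  have Q_eq: "Q = (\<lambda>x. measure M {\<omega>\<in>space M. T \<omega> > x})" by (simp add: Q_def fun_eq_iff)
  have initial: "(\<lambda>x. prob {\<omega>\<in>space M. x < \<bar>X 0 \<omega>\<bar>}) \<in> o[at_top](Q)"
  proof -
    \<comment> \<open>The entrywise hypothesis concerns \<open>X 0\<close> jointly with the initial
      state; a finite sum over that state keeps it \<open>o(Q)\<close>.\<close>
    have "prob {\<omega>\<in>space M. x < \<bar>X 0 \<omega>\<bar>} = (\<Sum>i<d. prob {\<omega>\<in>space M. \<bar>X 0 \<omega>\<bar> > x \<and> J 0 \<omega> = i})" for x
    proof -
      have "{\<omega>\<in>space M. x < \<bar>X 0 \<omega>\<bar>} = (\<Union>i\<in>{..<d}. {\<omega>\<in>space M. \<bar>X 0 \<omega>\<bar> > x \<and> J 0 \<omega> = i})"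
        using J_range by auto
      then show ?thesis
        by (simp only:) (rule finite_measure_finite_Union, auto simp: disjoint_family_on_def)
    qed
    then show ?thesis using beta_tail unfolding Q_eq by (auto intro!: big_sum_in_smallo)
  qed
  have jumps: "jump_tail \<in> o[at_top](Q)"
    unfolding jump_tail_def[abs_def] Q_eq \<mu>_def
    using H_tail by (intro big_sum_in_smallo) auto
  interpret map_random_time M F d X J \<mu> T G f h
  proof (intro map_random_time.intro map_random_time_axioms.intro map classC_tail_axioms)
    show "(\<Sum>j<d. \<integral>y. y \<partial>\<mu> i j) + (\<Sum>j<d. measure (\<mu> i j) UNIV * f j) - f i = h" if "i < d" for i
      using f[OF that] prob_mu(2)[OF that] by (simp add: m_def)
    show "indep_set {T -` B \<inter> space M | B. B \<in> sets borel} (sets G)"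
      unfolding sets_G by (rule T_indep)
  qed (use h_pos T_int X_G initial jumps in \<open>auto simp: G_def\<close>)
  show ?thesis using random_time_asymptotics unfolding N_def Q_eq by blast
qed

end
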